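(* Let $M^n$ be an $n$-dimensional Riemannian manifold, $\pi:TM^n\to M^n$ its tangent bundle, and let $N^l$ be an embedded $l$-dimensional submanifold of $TM^n$ which is transverse to the fiber at a point $z\in N^l$. Then there exist a submanifold $F^l$ of $M^n$ containing $x=\pi(z)$, a neighborhood $U$ of $x$ in $M^n$, a neighborhood $V$ of $z$ in $TM^n$, and a vector field $\xi$ on $M^n$ along $F^l\cap U$ such that $N^l\cap V=\xi(F^l\cap U)$.
   Context: All manifolds, maps and vector fields are smooth ($C^\infty$). Superscripts on manifolds denote dimensions. $N^l\subset TM^n$ is transverse to the fiber at $z\in N^l$ if $T_zN^l\cap \ker(d\pi_z)=\{0\}$, i.e. $T_zN^l$ meets the vertical subspace of $T_zTM^n$ only in $0$. A vector field on $M^n$ along a submanifold $F\subset M^n$ is a smooth map $\xi:F\to TM^n$ with $\pi\circ\xi=\mathrm{Id}_F$ (not necessarily tangent to $F$); $\xi(F)\subset TM^n$ denotes its image. *)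

theory Defs
  imports "HOL-Analysis.Analysis"
begin

section \<open>Smooth functions between Euclidean spaces\<close>

text \<open>The predicate \<open>Ck_on\<close> is meant for open sets \<open>W\<close>; the second clause asks that all
  directional derivatives are again of class \<open>C\<^sup>k\<close>.\<close>

primrec Ck_on ::
  "nat \<Rightarrow> 'a::euclidean_space set \<Rightarrow> ('a \<Rightarrow> 'b::real_normed_vector) \<Rightarrow> bool" where
  "Ck_on 0 W f \<longleftrightarrow> continuous_on W f"
| "Ck_on (Suc k) W f \<longleftrightarrow>
     (\<forall>x\<in>W. f differentiable (at x)) \<and>
     (\<forall>v. Ck_on k W (\<lambda>x. frechet_derivative f (at x) v))"

text \<open>Smoothness on an arbitrary subset: local extendability to a smooth function on an open
  set of the ambient space. On open sets this is ordinary \<open>C\<^sup>\<infinity>\<close>.\<close>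

definition smooth_on :: "'a::euclidean_space set \<Rightarrow> ('a \<Rightarrow> 'b::real_normed_vector) \<Rightarrow> bool" where
  "smooth_on S f \<longleftrightarrow>
     (\<forall>x\<in>S. \<exists>W h. open W \<and> x \<in> W \<and> (\<forall>k. Ck_on k W h) \<and> (\<forall>y\<in>S \<inter> W. h y = f y))"

section \<open>Smooth manifolds\<close>

text \<open>Charts take values in an \<open>n\<close>-dimensional linear subspace (the model space) of a Euclidean
  space, rather than in a Euclidean space type of dimension \<open>n\<close>, because the types of class
  \<open>euclidean_space\<close> have positive dimension; in this way \<open>n = 0\<close> is covered too.
  A chart is a pair of its domain and its coordinate map; the values of the coordinate map
  outside the domain are irrelevant.\<close>

type_synonym ('a, 'e) chart = "'a set \<times> ('a \<Rightarrow> 'e)"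

record ('a, 'e) manifold =
  mtop :: "'a topology"
  model :: "'e set"
  atlas :: "('a, 'e) chart set"

definition is_chart :: "'a topology \<Rightarrow> 'e::euclidean_space set \<Rightarrow> ('a, 'e) chart \<Rightarrow> bool" where
  "is_chart X E c \<longleftrightarrow> (case c of (U, \<phi>) \<Rightarrow>
     openin X U \<and> openin (top_of_set E) (\<phi> ` U) \<and>
     homeomorphic_map (subtopology X U) (top_of_set (\<phi> ` U)) \<phi>)"

definition compatible ::
  "('a, 'e::euclidean_space) chart \<Rightarrow> ('a, 'e) chart \<Rightarrow> bool" where
  "compatible c d \<longleftrightarrow> (case (c, d) of ((U, \<phi>), (V, \<psi>)) \<Rightarrow>
     smooth_on (\<phi> ` (U \<inter> V)) (\<psi> \<circ> inv_into U \<phi>) \<and>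
     smooth_on (\<psi> ` (U \<inter> V)) (\<phi> \<circ> inv_into V \<psi>))"

definition smooth_manifold :: "nat \<Rightarrow> ('a, 'e::euclidean_space) manifold \<Rightarrow> bool" where
  "smooth_manifold n M \<longleftrightarrow>
     subspace (model M) \<and> dim (model M) = n \<and>
     Hausdorff_space (mtop M) \<and> second_countable (mtop M) \<and>
     (\<Union>c\<in>atlas M. fst c) = topspace (mtop M) \<and>
     (\<forall>c\<in>atlas M. is_chart (mtop M) (model M) c) \<and>
     (\<forall>c\<in>atlas M. \<forall>d\<in>atlas M. compatible c d)"

text \<open>The maximal atlas determined by the given one.\<close>

definition smooth_charts :: "('a, 'e::euclidean_space) manifold \<Rightarrow> ('a, 'e) chart set" where
  "smooth_charts M =
     {c. is_chart (mtop M) (model M) c \<and> (\<forall>d\<in>atlas M. compatible c d)}"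

text \<open>Smoothness of a map on an arbitrary subset \<open>S\<close> of a manifold. For open \<open>S\<close> this is the usual
  notion; for an embedded submanifold \<open>S\<close> it is smoothness with respect to the induced
  structure.\<close>

definition smooth_map_on ::
  "('a, 'e::euclidean_space) manifold \<Rightarrow> ('b, 'f::euclidean_space) manifold \<Rightarrow>
   'a set \<Rightarrow> ('a \<Rightarrow> 'b) \<Rightarrow> bool" where
  "smooth_map_on M M' S f \<longleftrightarrow>
     (\<forall>p\<in>S. \<exists>(U, \<phi>)\<in>smooth_charts M. \<exists>(V, \<psi>)\<in>smooth_charts M'.
        p \<in> U \<and> f ` (S \<inter> U) \<subseteq> V \<and>
        smooth_on (\<phi> ` (S \<inter> U)) (\<psi> \<circ> f \<circ> inv_into U \<phi>))"

text \<open>Embedded submanifolds of dimension \<open>l\<close>, by slice charts.\<close>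

definition embedded_submanifold ::
  "nat \<Rightarrow> ('a, 'e::euclidean_space) manifold \<Rightarrow> 'a set \<Rightarrow> bool" where
  "embedded_submanifold l M S \<longleftrightarrow>
     S \<subseteq> topspace (mtop M) \<and>
     (\<forall>p\<in>S. \<exists>(U, \<phi>)\<in>smooth_charts M. p \<in> U \<and>
        (\<exists>L. subspace L \<and> L \<subseteq> model M \<and> dim L = l \<and> \<phi> ` (U \<inter> S) = \<phi> ` U \<inter> L))"

section \<open>Tangent vectors\<close>

text \<open>Tangent vectors at \<open>p\<close> are velocities of curves, that is, classes of curves through \<open>p\<close> at
  time \<open>0\<close>, smooth near \<open>0\<close>, modulo equality of first derivatives in charts. The values of the
  curves at times away from \<open>0\<close> are unconstrained.\<close>

definition curves_at :: "('a, 'e::euclidean_space) manifold \<Rightarrow> 'a \<Rightarrow> (real \<Rightarrow> 'a) set" where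
  "curves_at M p =
     {\<gamma>. \<gamma> 0 = p \<and>
        (\<exists>(U, \<phi>)\<in>smooth_charts M. \<exists>e>0.
           \<gamma> ` {-e<..<e} \<subseteq> U \<and> smooth_on {-e<..<e} (\<phi> \<circ> \<gamma>))}"

type_synonym 'a tangent_vector = "(real \<Rightarrow> 'a) set"

definition velocity ::
  "('a, 'e::euclidean_space) manifold \<Rightarrow> (real \<Rightarrow> 'a) \<Rightarrow> 'a tangent_vector" where
  "velocity M \<gamma> =
     {\<delta> \<in> curves_at M (\<gamma> 0). \<forall>(U, \<phi>)\<in>smooth_charts M. \<gamma> 0 \<in> U \<longrightarrow>
        vector_derivative (\<phi> \<circ> \<delta>) (at 0) = vector_derivative (\<phi> \<circ> \<gamma>) (at 0)}"

definition tangent_space ::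
  "('a, 'e::euclidean_space) manifold \<Rightarrow> 'a \<Rightarrow> 'a tangent_vector set" where
  "tangent_space M p = velocity M ` curves_at M p"

definition zero_tangent ::
  "('a, 'e::euclidean_space) manifold \<Rightarrow> 'a \<Rightarrow> 'a tangent_vector" where
  "zero_tangent M p = velocity M (\<lambda>_. p)"

text \<open>Coordinates of a tangent vector in a chart around its base point. The result does not
  depend on the chosen representative; the linear structure of the tangent space is the one for
  which this map is a linear isomorphism onto the model space.\<close>

definition tangent_coord :: "('a \<Rightarrow> 'e::euclidean_space) \<Rightarrow> 'a tangent_vector \<Rightarrow> 'e" where
  "tangent_coord \<phi> v = vector_derivative (\<phi> \<circ> (SOME \<gamma>. \<gamma> \<in> v)) (at 0)"

text \<open>The differential of a smooth map at any point, applied to a tangent vector there.\<close>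

definition differential ::
  "('b, 'f::euclidean_space) manifold \<Rightarrow> ('a \<Rightarrow> 'b) \<Rightarrow> 'a tangent_vector \<Rightarrow> 'b tangent_vector" where
  "differential M' f v = velocity M' (f \<circ> (SOME \<gamma>. \<gamma> \<in> v))"

text \<open>For an embedded submanifold \<open>S\<close> of \<open>M\<close> and \<open>p \<in> S\<close>, the tangent space of \<open>S\<close> at \<open>p\<close> as a
  subspace of the tangent space of \<open>M\<close> at \<open>p\<close>.\<close>

definition submanifold_tangent_space ::
  "('a, 'e::euclidean_space) manifold \<Rightarrow> 'a set \<Rightarrow> 'a \<Rightarrow> 'a tangent_vector set" where
  "submanifold_tangent_space M S p =
     {velocity M \<gamma> | \<gamma>. \<gamma> \<in> curves_at M p \<and> (\<forall>\<^sub>F t in at 0. \<gamma> t \<in> S)}"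

text \<open>A Riemannian metric assigns to \<open>p\<close> an inner product \<open>g p\<close> on the tangent space at \<open>p\<close>, smoothly
  in \<open>p\<close>. Bilinearity and smoothness are expressed in charts: \<open>G x\<close> is the coordinate expression
  of \<open>g p\<close> at \<open>x = \<phi> p\<close>. Only its values on the model space are determined by \<open>g\<close>, and any bilinear
  form on the model space extends to the whole type.\<close>

definition riemannian_metric ::
  "('a, 'e::euclidean_space) manifold \<Rightarrow>
   ('a \<Rightarrow> 'a tangent_vector \<Rightarrow> 'a tangent_vector \<Rightarrow> real) \<Rightarrow> bool" where
  "riemannian_metric M g \<longleftrightarrow>
     (\<forall>p\<in>topspace (mtop M). \<forall>v\<in>tangent_space M p. \<forall>w\<in>tangent_space M p. g p v w = g p w v) \<and>
     (\<forall>p\<in>topspace (mtop M). \<forall>v\<in>tangent_space M p. v \<noteq> zero_tangent M p \<longrightarrow> g p v v > 0) \<and>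
     (\<forall>(U, \<phi>)\<in>atlas M. \<exists>G.
        (\<forall>x. bilinear (G x)) \<and>
        (\<forall>a\<in>model M. \<forall>b\<in>model M. smooth_on (\<phi> ` U) (\<lambda>x. G x a b)) \<and>
        (\<forall>p\<in>U. \<forall>v\<in>tangent_space M p. \<forall>w\<in>tangent_space M p.
           g p v w = G (\<phi> p) (tangent_coord \<phi> v) (tangent_coord \<phi> w)))"

section \<open>The tangent bundle\<close>

definition tangent_points ::
  "('a, 'e::euclidean_space) manifold \<Rightarrow> ('a \<times> 'a tangent_vector) set" where
  "tangent_points M = (SIGMA p:topspace (mtop M). tangent_space M p)"

abbreviation bundle_proj :: "'a \<times> 'a tangent_vector \<Rightarrow> 'a" where
  "bundle_proj \<equiv> fst"

definition bundle_chart ::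
  "('a, 'e::euclidean_space) manifold \<Rightarrow> ('a, 'e) chart \<Rightarrow>
   ('a \<times> 'a tangent_vector, 'e \<times> 'e) chart" where
  "bundle_chart M c = (case c of (U, \<phi>) \<Rightarrow>
     ({z \<in> tangent_points M. bundle_proj z \<in> U}, \<lambda>(p, v). (\<phi> p, tangent_coord \<phi> v)))"

text \<open>A set of tangent vectors is open iff its image under every chart induced from the atlas
  is open in the model space.\<close>

definition tangent_bundle ::
  "('a, 'e::euclidean_space) manifold \<Rightarrow> ('a \<times> 'a tangent_vector, 'e \<times> 'e) manifold" where
  "tangent_bundle M =
     \<lparr>mtop = topology (\<lambda>W. W \<subseteq> tangent_points M \<and>
        (\<forall>c\<in>atlas M. case bundle_chart M c of (T, \<Phi>) \<Rightarrow>
           openin (top_of_set (model M \<times> model M)) (\<Phi> ` (W \<inter> T)))),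
      model = model M \<times> model M,
      atlas = bundle_chart M ` atlas M\<rparr>"

definition vertical_space ::
  "('a, 'e::euclidean_space) manifold \<Rightarrow> 'a \<times> 'a tangent_vector \<Rightarrow>
   ('a \<times> 'a tangent_vector) tangent_vector set" where
  "vertical_space M z =
     {w \<in> tangent_space (tangent_bundle M) z.
        differential M bundle_proj w = zero_tangent M (bundle_proj z)}"

definition transverse_to_fiber_at ::
  "('a, 'e::euclidean_space) manifold \<Rightarrow> ('a \<times> 'a tangent_vector) set \<Rightarrow>
   'a \<times> 'a tangent_vector \<Rightarrow> bool" where
  "transverse_to_fiber_at M N z \<longleftrightarrow>
     submanifold_tangent_space (tangent_bundle M) N z \<inter> vertical_space M z =
       {zero_tangent (tangent_bundle M) z}"

definition vector_field_along ::
  "('a, 'e::euclidean_space) manifold \<Rightarrow> 'a set \<Rightarrow> ('a \<Rightarrow> 'a \<times> 'a tangent_vector) \<Rightarrow> bool" where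
  "vector_field_along M F \<xi> \<longleftrightarrow>
     smooth_map_on M (tangent_bundle M) F \<xi> \<and>
     (\<forall>p\<in>F. \<xi> p \<in> tangent_points M \<and> bundle_proj (\<xi> p) = p)"

end

theory Submission
  imports Defs
begin

text \<open>Let \<open>\<alpha>\<close> be a slice chart of the tangent bundle at \<open>z\<close> sending \<open>N\<close> into a subspace \<open>L\<close>. In a
  chart \<open>\<phi>\<close> of \<open>M\<close> the bundle projection becomes a smooth map \<open>f\<close> with \<open>f \<circ> \<alpha> = \<phi> \<circ> \<pi>\<close>, and
  transversality says that its derivative \<open>D\<close> at \<open>\<alpha> z\<close> is injective on \<open>L\<close>. With a left inverse \<open>B\<close>
  of \<open>D\<close> on \<open>L\<close>, the map \<open>G y = f (\<alpha> z + B y) + (y - D (B y))\<close> has derivative the identity at \<open>0\<close>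
  and carries \<open>D L\<close> near \<open>0\<close> onto the image of \<open>L\<close> under \<open>f\<close>. Hence \<open>\<psi> = G\<inverse> \<circ> \<phi>\<close> is a chart of \<open>M\<close> in
  which \<open>F = {p. \<psi> p \<in> D L}\<close> is a slice, and \<open>\<xi> p = \<alpha>\<inverse> (\<alpha> z + B (\<psi> p))\<close> is the required field; it is
  smooth because it is affine in the charts \<open>\<psi>\<close> and \<open>\<alpha>\<close>.\<close>

section \<open>Functions of class \<open>C\<^sup>k\<close>\<close>

lemma Ck_on_cong:
  assumes "open W" "\<And>x. x \<in> W \<Longrightarrow> f x = g x"
  shows "Ck_on k W f \<longleftrightarrow> Ck_on k W g"
  using assms(2)
proof (induction k arbitrary: f g)
  case 0
  then show ?case by (simp cong: continuous_on_cong)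
next
  case (Suc k)
  \<comment> \<open>Quantifying over every candidate \<open>D\<close> makes the Hilbert choices
    behind the two \<open>frechet_derivative\<close> terms equal at each point of \<open>W\<close>,
    which is what the induction hypothesis asks for.\<close>
  have der: "(f has_derivative D) (at x) \<longleftrightarrow> (g has_derivative D) (at x)" if "x \<in> W" for x D
    by (rule iffI; erule has_derivative_transform_within_open[OF _ \<open>open W\<close> that])
      (simp_all add: Suc.prems)
  have "Ck_on k W (\<lambda>x. frechet_derivative f (at x) v) \<longleftrightarrow>
      Ck_on k W (\<lambda>x. frechet_derivative g (at x) v)" for v
    by (rule Suc.IH) (simp add: frechet_derivative_def der)
  moreover have "f differentiable (at x) \<longleftrightarrow> g differentiable (at x)" if "x \<in> W" for x
    using der[OF that] by (simp add: differentiable_def)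
  ultimately show ?case by simp
qed

lemma Ck_on_subset: "Ck_on k W f \<Longrightarrow> W' \<subseteq> W \<Longrightarrow> Ck_on k W' f"
  by (induction k arbitrary: f) (auto intro: continuous_on_subset)

text \<open>By uniqueness of derivatives, an explicit formula \<open>f'\<close> valid on
  \<open>W\<close> may stand in for \<open>frechet_derivative\<close>; the closure rules below rest
  on this.\<close>

lemma Ck_on_SucI:
  assumes "open W" "\<And>x. x \<in> W \<Longrightarrow> (f has_derivative f' x) (at x)"
    and "\<And>v. Ck_on k W (\<lambda>x. f' x v)"
  shows "Ck_on (Suc k) W f"
proof -
  have "Ck_on k W (\<lambda>x. frechet_derivative f (at x) v)" for v
    by (subst Ck_on_cong[OF assms(1), of _ "\<lambda>x. f' x v"])
      (simp_all add: assms(3) frechet_derivative_at[OF assms(2), symmetric])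
  then show ?thesis using assms(2) by (auto simp: differentiable_def)
qed

lemma Ck_on_SucD:
  assumes "Ck_on (Suc k) W f"
  shows "x \<in> W \<Longrightarrow> (f has_derivative frechet_derivative f (at x)) (at x)"
    and "Ck_on k W (\<lambda>x. frechet_derivative f (at x) v)"
  using assms by (auto simp: frechet_derivative_works)

lemma Ck_on_Suc_imp: "Ck_on (Suc k) W f \<Longrightarrow> Ck_on k W f"
proof (induction k arbitrary: f)
  case 0
  then show ?case
    by (auto simp: continuous_on_eq_continuous_within
        intro: differentiable_imp_continuous_within differentiable_at_withinI)
next
  case (Suc k)
  then show ?case by (metis Ck_on.simps(2))
qed

lemma Ck_on_imp_continuous_on: "Ck_on k W f \<Longrightarrow> continuous_on W f"
proof (induction k)
  case (Suc k)
  then show ?case using Ck_on_Suc_imp by blast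
qed simp

lemma Ck_on_const: "open W \<Longrightarrow> Ck_on k W (\<lambda>x. c)"
proof (induction k arbitrary: c)
  case (Suc k)
  show ?case by (rule Ck_on_SucI[where f' = "\<lambda>x v. 0"]) (use Suc in auto)
qed simp

lemma Ck_on_id: "open W \<Longrightarrow> Ck_on k W (\<lambda>x. x)"
proof (cases k)
  case (Suc k)
  assume "open W"
  show ?thesis unfolding Suc
    by (rule Ck_on_SucI[where f' = "\<lambda>x v. v"]) (use \<open>open W\<close> in \<open>auto intro: Ck_on_const\<close>)
qed simp

lemma Ck_on_bounded_linear:
  assumes "open W" "bounded_linear A" "Ck_on k W f"
  shows "Ck_on k W (\<lambda>x. A (f x))"
  using assms(3)
proof (induction k arbitrary: f)
  case 0
  then show ?case using bounded_linear.continuous_on[OF assms(2)] by simp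
next
  case (Suc k)
  show ?case
    by (intro Ck_on_SucI[OF assms(1), where f' = "\<lambda>x v. A (frechet_derivative f (at x) v)"]
        bounded_linear.has_derivative[OF assms(2)] Suc.IH Ck_on_SucD[OF Suc.prems])
qed

lemma Ck_on_add:
  assumes "open W" "Ck_on k W f" "Ck_on k W g"
  shows "Ck_on k W (\<lambda>x. f x + g x)"
  using assms(2,3)
proof (induction k arbitrary: f g)
  case (Suc k)
  show ?case
    by (rule Ck_on_SucI[OF assms(1), where
          f' = "\<lambda>x v. frechet_derivative f (at x) v + frechet_derivative g (at x) v"])
      (use Ck_on_SucD[OF Suc.prems(1)] Ck_on_SucD[OF Suc.prems(2)] Suc.IH in
        \<open>auto intro: has_derivative_add\<close>)
qed (simp add: continuous_on_add)

lemma Ck_on_sum: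
  assumes "open W" "\<And>i. i \<in> I \<Longrightarrow> Ck_on k W (f i)"
  shows "Ck_on k W (\<lambda>x. \<Sum>i\<in>I. f i x)"
  using assms(2)
proof (induction I rule: infinite_finite_induct)
  case (insert i I)
  have "Ck_on k W (\<lambda>x. f i x + (\<Sum>i\<in>I. f i x))"
    by (rule Ck_on_add[OF assms(1)]) (simp_all add: insert)
  then show ?case using insert by simp
qed (simp_all add: Ck_on_const[OF assms(1)])

lemma Ck_on_scaleR:
  fixes f :: "'a::euclidean_space \<Rightarrow> real"
  assumes "open W" "Ck_on k W f" "Ck_on k W g"
  shows "Ck_on k W (\<lambda>x. f x *\<^sub>R g x)"
  using assms(2,3)
proof (induction k arbitrary: f g)
  case (Suc k)
  have "Ck_on k W (\<lambda>x. f x *\<^sub>R frechet_derivative g (at x) v +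
      frechet_derivative f (at x) v *\<^sub>R g x)" for v
    by (intro Ck_on_add assms(1) Suc.IH Ck_on_SucD(2) Suc.prems Ck_on_Suc_imp)
  then show ?case
    by (intro Ck_on_SucI[OF assms(1), where f' = "\<lambda>x v. f x *\<^sub>R frechet_derivative g (at x) v +
        frechet_derivative f (at x) v *\<^sub>R g x"] has_derivative_scaleR
        Ck_on_SucD(1)[OF Suc.prems(1)] Ck_on_SucD(1)[OF Suc.prems(2)])
qed (simp add: continuous_on_scaleR)

section \<open>The chain rule\<close>

lemma linear_euclidean_expansion:
  fixes f :: "'a::euclidean_space \<Rightarrow> 'b::real_vector"
  assumes "linear f"
  shows "f x = (\<Sum>b\<in>Basis. (x \<bullet> b) *\<^sub>R f b)"
proof -
  have "f x = f (\<Sum>b\<in>Basis. (x \<bullet> b) *\<^sub>R b)" by (simp add: euclidean_representation)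
  then show ?thesis by (simp only: linear_sum[OF assms] linear_scale[OF assms])
qed

text \<open>In the chain rule both the linear map and its argument vary with the point. Expanding
  the argument in \<open>Basis\<close> leaves a finite sum of scalar functions times values on fixed
  vectors.\<close>

lemma Ck_on_linear_family:
  fixes A :: "'a::euclidean_space \<Rightarrow> 'b::euclidean_space \<Rightarrow> 'c::real_normed_vector"
  assumes "open W" "\<And>x. x \<in> W \<Longrightarrow> linear (A x)" "\<And>b. Ck_on k W (\<lambda>x. A x b)" "Ck_on k W f"
  shows "Ck_on k W (\<lambda>x. A x (f x))"
proof -
  have "Ck_on k W (\<lambda>x. \<Sum>b\<in>Basis. (f x \<bullet> b) *\<^sub>R A x b)"
    by (intro Ck_on_sum Ck_on_scaleR assms
        Ck_on_bounded_linear[OF _ bounded_linear_inner_left])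
  then show ?thesis
    by (subst Ck_on_cong[OF assms(1) linear_euclidean_expansion[OF assms(2)]])
qed

lemma Ck_on_compose:
  fixes f :: "'a::euclidean_space \<Rightarrow> 'b::euclidean_space" and g :: "'b \<Rightarrow> 'c::real_normed_vector"
  assumes "open W" "Ck_on k W f" "Ck_on k W' g" "f ` W \<subseteq> W'"
  shows "Ck_on k W (\<lambda>x. g (f x))"
  using assms(2,3)
proof (induction k arbitrary: g)
  case 0
  then show ?case using assms(4) by (auto intro: continuous_on_compose2)
next
  case (Suc k)
  have f: "(f has_derivative frechet_derivative f (at x)) (at x)" if "x \<in> W" for x
    by (rule Ck_on_SucD(1)[OF Suc.prems(1) that])
  have g: "(g has_derivative frechet_derivative g (at (f x))) (at (f x))" if "x \<in> W" for x
    using Ck_on_SucD(1)[OF Suc.prems(2)] that assms(4) by blast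
  \<comment> \<open>The inner map \<open>f\<close> is fixed throughout the induction; the hypothesis
    is applied to the directional derivatives of \<open>g\<close>, which are one class
    lower.\<close>
  have Dg: "Ck_on k W (\<lambda>x. frechet_derivative g (at (f x)) b)" for b
    using Suc.IH[OF Ck_on_Suc_imp[OF Suc.prems(1)] Ck_on_SucD(2)[OF Suc.prems(2)]] .
  show ?case
  proof (rule Ck_on_SucI[OF assms(1) has_derivative_compose[OF f g]])
    show "Ck_on k W (\<lambda>x. frechet_derivative g (at (f x)) (frechet_derivative f (at x) v))" for v
      by (rule Ck_on_linear_family[OF assms(1) has_derivative_linear[OF g] Dg
            Ck_on_SucD(2)[OF Suc.prems(1)]])
  qed
qed

section \<open>The smooth inverse function theorem\<close>

text \<open>Continuity of \<open>g\<close> at \<open>x\<close> suffices because \<open>f\<close>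
  vanishes there: \<open>f y\<close> is of order \<open>norm (y - x)\<close>, so
  \<open>f y *\<^sub>R (g y - g x)\<close> is of smaller order and only
  \<open>f y *\<^sub>R g x\<close> contributes to the derivative.\<close>

lemma has_derivative_scaleR_vanishing:
  fixes f :: "'a::real_normed_vector \<Rightarrow> real" and g :: "'a \<Rightarrow> 'b::real_normed_vector"
  assumes f: "(f has_derivative f') (at x)" and "f x = 0" and g: "(g \<longlongrightarrow> g x) (at x)"
  shows "((\<lambda>y. f y *\<^sub>R g y) has_derivative (\<lambda>h. f' h *\<^sub>R g x)) (at x)"
proof -
  \<comment> \<open>\<open>e\<close> is the normalised remainder of the first-order expansion of
    \<open>f\<close> at \<open>x\<close>; with the bound \<open>K\<close> of \<open>f'\<close> it
    controls \<open>\<bar>f y\<bar>\<close> by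
    \<open>norm (y - x) * (K + \<bar>e y\<bar>)\<close>.\<close>
  define e where "e = (\<lambda>y. (f y - f' (y - x)) /\<^sub>R norm (y - x))"
  have lin: "bounded_linear f'" and e: "(e \<longlongrightarrow> 0) (at x)"
    using f \<open>f x = 0\<close> by (auto simp: has_derivative_at_within e_def)
  obtain K where K: "\<And>h. \<bar>f' h\<bar> \<le> norm h * K"
    using bounded_linear.bounded[OF lin] by auto
  have fe: "f y = f' (y - x) + norm (y - x) * e y" if "y \<noteq> x" for y
    using that by (simp add: e_def field_simps)
  have "((\<lambda>y. f y *\<^sub>R (g y - g x)) has_derivative (\<lambda>h. 0)) (at x)"
    unfolding has_derivative_at_within
  proof (intro conjI bounded_linear_zero)
    have "norm ((f y *\<^sub>R (g y - g x)) /\<^sub>R norm (y - x)) \<le> (K + \<bar>e y\<bar>) * norm (g y - g x)"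
      if "y \<noteq> x" for y
    proof -
      have "\<bar>f y\<bar> \<le> norm (y - x) * (K + \<bar>e y\<bar>)"
      proof -
        have "\<bar>f y\<bar> \<le> \<bar>f' (y - x)\<bar> + norm (y - x) * \<bar>e y\<bar>"
          using abs_triangle_ineq[of "f' (y - x)" "norm (y - x) * e y"]
          by (simp only: fe[OF that] abs_mult abs_norm_cancel)
        then show ?thesis
          using K[of "y - x"] by (simp only: distrib_left)
      qed
      then have "\<bar>f y\<bar> / norm (y - x) \<le> K + \<bar>e y\<bar>"
        using that by (simp add: pos_divide_le_eq mult.commute)
      then have "\<bar>f y\<bar> / norm (y - x) * norm (g y - g x) \<le> (K + \<bar>e y\<bar>) * norm (g y - g x)"
        by (rule mult_right_mono) simp
      then show ?thesis by (simp only: norm_scaleR abs_inverse abs_norm_cancel divide_inverse mult_ac)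
    qed
    then have bound: "\<forall>\<^sub>F y in at x. norm ((f y *\<^sub>R (g y - g x)) /\<^sub>R norm (y - x))
        \<le> (K + \<bar>e y\<bar>) * norm (g y - g x)"
      unfolding eventually_at_filter by (intro always_eventually) blast
    have "((\<lambda>y. (K + \<bar>e y\<bar>) * norm (g y - g x)) \<longlongrightarrow> (K + \<bar>0\<bar>) * norm (g x - g x)) (at x)"
      by (intro tendsto_intros e g)
    then have "((\<lambda>y. (f y *\<^sub>R (g y - g x)) /\<^sub>R norm (y - x)) \<longlongrightarrow> 0) (at x)"
      by (intro Lim_null_comparison[OF bound]) simp
    then show "((\<lambda>y. (f y *\<^sub>R (g y - g x) - f x *\<^sub>R (g x - g x) - 0) /\<^sub>R norm (y - x))
        \<longlongrightarrow> 0) (at x)"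
      by simp
  qed
  from has_derivative_add[OF has_derivative_scaleR_left[OF f, of "g x"] this]
  show ?thesis by (simp add: algebra_simps)
qed

text \<open>\<open>A0\<close> is bounded below by some \<open>c\<close>. Once \<open>A y\<close> is
  close to \<open>A0\<close> on \<open>Basis\<close>, the two differ by at most \<open>c / 2\<close>
  in operator norm, so \<open>A y\<close> is bounded below by \<open>c / 2\<close>. With
  \<open>u = inv A0 v\<close> the error of \<open>inv (A y) v\<close> is then at most
  \<open>2 / c * norm (v - A y u)\<close>, which tends to \<open>0\<close>.\<close>

lemma tendsto_inv_linear_family:
  fixes A :: "'a::topological_space \<Rightarrow> 'b::euclidean_space \<Rightarrow> 'b"
  assumes lin: "\<forall>\<^sub>F y in F. linear (A y)" and bij: "\<forall>\<^sub>F y in F. bij (A y)"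
    and lim: "\<And>b. ((\<lambda>y. A y b) \<longlongrightarrow> A0 b) F" and A0: "linear A0" "bij A0"
  shows "((\<lambda>y. inv (A y) v) \<longlongrightarrow> inv A0 v) F"
proof -
  define u where "u = inv A0 v"
  have A0u: "A0 u = v"
    using A0(2) by (simp add: u_def bij_is_surj surj_f_inv_f)
  obtain c where c: "c > 0" "\<And>b. c * norm b \<le> norm (A0 b)"
    using linear_inj_bounded_below_pos[OF A0(1) bij_is_inj[OF A0(2)]] by blast
  have "((\<lambda>y. \<Sum>i\<in>Basis. norm (A y i - A0 i)) \<longlongrightarrow> (\<Sum>i\<in>(Basis::'b set). norm (A0 i - A0 i))) F"
    by (intro tendsto_intros lim)
  then have "\<forall>\<^sub>F y in F. (\<Sum>i\<in>Basis. norm (A y i - A0 i)) < c / 2"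
    by (rule order_tendstoD) (use c in simp)
  then have bound: "\<forall>\<^sub>F y in F. norm (inv (A y) v - u) \<le> 2 / c * norm (v - A y u)"
    using lin bij
  proof eventually_elim
    case (elim y)
    have close: "norm (A y b - A0 b) \<le> c / 2 * norm b" for b
    proof -
      have "A y b - A0 b = (\<Sum>i\<in>Basis. (b \<bullet> i) *\<^sub>R (A y i - A0 i))"
        by (simp add: linear_euclidean_expansion[OF elim(2), of b]
            linear_euclidean_expansion[OF A0(1), of b] sum_subtractf scaleR_diff_right)
      also have "norm \<dots> \<le> (\<Sum>i\<in>Basis. norm b * norm (A y i - A0 i))"
        by (intro sum_norm_le) (simp add: mult_right_mono Basis_le_norm)
      also have "\<dots> \<le> c / 2 * norm b"
        using mult_left_mono[OF less_imp_le[OF elim(1)], of "norm b"]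
        by (simp add: sum_distrib_left mult.commute)
      finally show ?thesis .
    qed
    define b where "b = inv (A y) v - u"
    have "A y b = v - A y u"
      using elim(3) by (simp add: b_def linear_diff[OF elim(2)] bij_is_surj surj_f_inv_f)
    moreover have "c * norm b \<le> norm (A y b) + c / 2 * norm b"
      using c(2)[of b] close[of b] norm_triangle_ineq4[of "A y b" "A y b - A0 b"] by simp
    ultimately have "c * norm b \<le> norm (v - A y u) + c / 2 * norm b"
      by simp
    then have "c * norm b \<le> 2 * norm (v - A y u)"
      by simp
    then show ?case
      unfolding b_def[symmetric] using c(1) by (simp add: pos_le_divide_eq mult.commute)
  qed
  have "((\<lambda>y. 2 / c * norm (v - A y u)) \<longlongrightarrow> 2 / c * norm (v - A0 u)) F"
    by (intro tendsto_intros lim)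
  then have "((\<lambda>y. inv (A y) v - u) \<longlongrightarrow> 0) F"
    using A0u by (intro Lim_null_comparison[OF bound]) simp
  then show ?thesis by (simp add: u_def LIM_zero_iff)
qed

text \<open>With \<open>u = (A x)\<inverse> v\<close> fixed, \<open>(A y)\<inverse> v = u + (A y)\<inverse> (v - A y u)\<close>, and \<open>v - A y u\<close> vanishes at
  \<open>y = x\<close>; so differentiability needs only the continuity of \<open>y \<mapsto> (A y)\<inverse>\<close>.\<close>

lemma Ck_on_inv_linear_family:
  fixes A :: "'a::euclidean_space \<Rightarrow> 'b::euclidean_space \<Rightarrow> 'b"
  assumes "open W" and lin: "\<And>x. x \<in> W \<Longrightarrow> linear (A x)" and bij: "\<And>x. x \<in> W \<Longrightarrow> bij (A x)"
    and "\<And>b. Ck_on k W (\<lambda>x. A x b)"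
  shows "Ck_on k W (\<lambda>x. inv (A x) v)"
proof -
  have tendsto: "((\<lambda>y. inv (A y) v) \<longlongrightarrow> inv (A x) v) (at x)"
    if "\<And>b. continuous_on W (\<lambda>x. A x b)" "x \<in> W" for x v
  proof (rule tendsto_inv_linear_family)
    have W: "\<forall>\<^sub>F y in at x. y \<in> W"
      using \<open>open W\<close> \<open>x \<in> W\<close> by (rule eventually_at_in_open')
    show "\<forall>\<^sub>F y in at x. linear (A y)" "\<forall>\<^sub>F y in at x. bij (A y)"
      using W by (auto elim: eventually_mono intro: lin bij)
    show "((\<lambda>y. A y b) \<longlongrightarrow> A x b) (at x)" for b
      using that \<open>open W\<close> by (metis at_within_open continuous_on_def)
  qed (use that lin bij in auto)
  show ?thesis
    using assms(4)
  proof (induction k arbitrary: v)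
    case 0
    then show ?case using tendsto
      by (simp add: continuous_on_def at_within_open[OF _ \<open>open W\<close>])
  next
    case (Suc k)
    have cont: "continuous_on W (\<lambda>x. A x b)" for b
      by (rule Ck_on_imp_continuous_on[OF Suc.prems])
    \<comment> \<open>With \<open>u = inv (A x) v\<close>, \<open>D x\<close> is the derivative at
      \<open>x\<close> of the residual \<open>v - A y u\<close> as a function of \<open>y\<close>.
      The derivative established below, \<open>inv (A x) (D x h)\<close> expanded in
      \<open>Basis\<close>, is the familiar \<open>- A\<inverse> A' A\<inverse> v\<close>.\<close>
    define D where "D x h = - (\<Sum>c\<in>Basis. (inv (A x) v \<bullet> c) *\<^sub>R
        frechet_derivative (\<lambda>y. A y c) (at x) h)" for x h
    show ?case
    proof (rule Ck_on_SucI[OF \<open>open W\<close>])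
      fix x assume x: "x \<in> W"
      define u where "u = inv (A x) v"
      define r where "r y = v - A y u" for y
      have Axu: "A x u = v"
        using bij[OF x] by (simp add: u_def bij_is_surj surj_f_inv_f)
      have "((\<lambda>y. v - (\<Sum>c\<in>Basis. (u \<bullet> c) *\<^sub>R A y c)) has_derivative
          (\<lambda>h. 0 - (\<Sum>c\<in>Basis. (u \<bullet> c) *\<^sub>R frechet_derivative (\<lambda>y. A y c) (at x) h))) (at x)"
        by (intro has_derivative_diff has_derivative_const has_derivative_sum
            has_derivative_scaleR_right Ck_on_SucD(1)[OF Suc.prems x])
      moreover have "v - (\<Sum>c\<in>Basis. (u \<bullet> c) *\<^sub>R A y c) = r y" if "y \<in> W" for y
        unfolding r_def by (subst linear_euclidean_expansion[OF lin[OF that], of u]) (rule refl)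
      ultimately have "(r has_derivative
          (\<lambda>h. 0 - (\<Sum>c\<in>Basis. (u \<bullet> c) *\<^sub>R frechet_derivative (\<lambda>y. A y c) (at x) h))) (at x)"
        by (rule has_derivative_transform_within_open[OF _ \<open>open W\<close> x])
      then have r: "(r has_derivative D x) (at x)"
        by (simp add: D_def[abs_def] u_def)
      \<comment> \<open>The scalar factor is differentiable and vanishes at \<open>x\<close>; of the
        other factor \<open>inv (A y) b\<close> only continuity is used.\<close>
      have "((\<lambda>y. (r y \<bullet> b) *\<^sub>R inv (A y) b) has_derivative
          (\<lambda>h. (D x h \<bullet> b) *\<^sub>R inv (A x) b)) (at x)" for b
        by (rule has_derivative_scaleR_vanishing[OF has_derivative_inner_left[OF r] _
              tendsto[OF cont x]]) (simp add: r_def Axu)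
      then have "((\<lambda>y. u + (\<Sum>b\<in>Basis. (r y \<bullet> b) *\<^sub>R inv (A y) b)) has_derivative
          (\<lambda>h. 0 + (\<Sum>b\<in>Basis. (D x h \<bullet> b) *\<^sub>R inv (A x) b))) (at x)"
        by (intro has_derivative_add has_derivative_const has_derivative_sum)
      moreover have "u + (\<Sum>b\<in>Basis. (r y \<bullet> b) *\<^sub>R inv (A y) b) = inv (A y) v" if "y \<in> W" for y
      proof -
        have lin': "linear (inv (A y))"
          by (rule inj_linear_imp_inv_linear[OF lin[OF that] bij_is_inj[OF bij[OF that]]])
        have "u = inv (A y) (A y u)"
          using bij[OF that] by (simp add: bij_is_inj)
        moreover have "(\<Sum>b\<in>Basis. (r y \<bullet> b) *\<^sub>R inv (A y) b) = inv (A y) v - inv (A y) (A y u)"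
          unfolding linear_euclidean_expansion[OF lin', symmetric] r_def by (rule linear_diff[OF lin'])
        ultimately show ?thesis by simp
      qed
      ultimately have "((\<lambda>y. inv (A y) v) has_derivative
          (\<lambda>h. 0 + (\<Sum>b\<in>Basis. (D x h \<bullet> b) *\<^sub>R inv (A x) b))) (at x)"
        by (rule has_derivative_transform_within_open[OF _ \<open>open W\<close> x])
      then show "((\<lambda>y. inv (A y) v) has_derivative
          (\<lambda>h. \<Sum>b\<in>Basis. (D x h \<bullet> b) *\<^sub>R inv (A x) b)) (at x)"
        by simp
    next
      fix h
      have inv: "Ck_on k W (\<lambda>x. inv (A x) w)" for w
        by (rule Suc.IH[OF Ck_on_Suc_imp[OF Suc.prems]])
      have inner: "Ck_on k W (\<lambda>x. f x \<bullet> b)" if "Ck_on k W f" for f :: "'a \<Rightarrow> 'b" and b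
        by (rule Ck_on_bounded_linear[OF \<open>open W\<close> bounded_linear_inner_left that])
      have "Ck_on k W (\<lambda>x. D x h)"
        unfolding D_def
        by (rule Ck_on_bounded_linear[OF \<open>open W\<close> bounded_linear_minus[OF bounded_linear_ident]],
            rule Ck_on_sum[OF \<open>open W\<close>], rule Ck_on_scaleR[OF \<open>open W\<close> inner[OF inv]],
            rule Ck_on_SucD(2)[OF Suc.prems])
      then show "Ck_on k W (\<lambda>x. \<Sum>b\<in>Basis. (D x h \<bullet> b) *\<^sub>R inv (A x) b)"
        by (intro Ck_on_sum[OF \<open>open W\<close>] Ck_on_scaleR[OF \<open>open W\<close> inner inv])
    qed
  qed
qed

text \<open>The \<open>C^1\<close> theorem yields an inverse \<open>K\<close> with derivative
  \<open>inv (G' (K y))\<close>. This formula raises regularity: if \<open>K\<close> is of class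
  \<open>C^k\<close>, so is the family \<open>G' (K y)\<close>, hence also its inverse, and
  therefore \<open>K\<close> is of class \<open>C^(k+1)\<close>.\<close>

theorem smooth_inverse_function:
  fixes G :: "'a::euclidean_space \<Rightarrow> 'a"
  assumes "open Y" "\<And>k. Ck_on k Y G" "x0 \<in> Y" "inj (frechet_derivative G (at x0))"
  obtains U V K where "open U" "U \<subseteq> Y" "x0 \<in> U" "open V" "G x0 \<in> V"
    "homeomorphism U V G K" "\<And>k. Ck_on k V K"
proof -
  \<comment> \<open>The inverse function theorem asks for a derivative continuous in operator norm;
    in finite dimension continuity in each direction implies this.\<close>
  define G' where "G' x = Blinfun (frechet_derivative G (at x))" for x
  have der: "(G has_derivative frechet_derivative G (at x)) (at x)" if "x \<in> Y" for x
    by (rule Ck_on_SucD(1)[OF assms(2) that])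
  have G': "blinfun_apply (G' x) = frechet_derivative G (at x)" if "x \<in> Y" for x
    using has_derivative_bounded_linear[OF der[OF that]]
    by (simp add: G'_def bounded_linear_Blinfun_apply)
  have "continuous_on Y (\<lambda>x. frechet_derivative G (at x) v)" for v
    using Ck_on_SucD(2)[OF assms(2)[of "Suc 0"]] by simp
  then have cont: "continuous_on Y G'"
    by (intro continuous_on_blinfun_componentwise) (simp add: G' cong: continuous_on_cong)
  obtain B where B: "linear B" "B \<circ> frechet_derivative G (at x0) = id"
    using linear_injective_left_inverse[OF has_derivative_linear[OF der[OF \<open>x0 \<in> Y\<close>]] assms(4)]
    by blast
  have der': "(G has_derivative blinfun_apply (G' x)) (at x)" if "x \<in> Y" for x
    using der[OF that] by (simp add: G'[OF that])
  have "Blinfun B o\<^sub>L G' x0 = id_blinfun"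
    using B G'[OF \<open>x0 \<in> Y\<close>]
    by (intro blinfun_eqI)
      (simp add: bounded_linear_Blinfun_apply linear_conv_bounded_linear fun_eq_iff)
  from inverse_function_theorem[OF \<open>open Y\<close> der' cont \<open>x0 \<in> Y\<close> this]
  obtain U V K K' where UV: "open U" "U \<subseteq> Y" "x0 \<in> U" "open V" "G x0 \<in> V"
      "homeomorphism U V G K"
    and K: "\<And>y. y \<in> V \<Longrightarrow> (K has_derivative (K' y)) (at y)"
      "\<And>y. y \<in> V \<Longrightarrow> K' y = inv (blinfun_apply (G' (K y)))"
      "\<And>y. y \<in> V \<Longrightarrow> bij (blinfun_apply (G' (K y)))"
    by blast
  have KV: "K ` V \<subseteq> Y"
    using UV by (auto simp: homeomorphism_def)
  have "Ck_on k V K" for k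
  proof (induction k)
    case 0
    then show ?case using UV(6) by (simp add: homeomorphism_def)
  next
    case (Suc k)
    show ?case
    proof (rule Ck_on_SucI[OF \<open>open V\<close>])
      show "(K has_derivative inv (frechet_derivative G (at (K y)))) (at y)" if "y \<in> V" for y
        using K(1,2)[OF that] G' KV that by (metis image_subset_iff)
      show "Ck_on k V (\<lambda>y. inv (frechet_derivative G (at (K y))) v)" for v
      proof (rule Ck_on_inv_linear_family[OF \<open>open V\<close>])
        show "linear (frechet_derivative G (at (K y)))" if "y \<in> V" for y
          using der KV that has_derivative_linear by blast
        show "bij (frechet_derivative G (at (K y)))" if "y \<in> V" for y
          using K(3)[OF that] G' KV that by (metis image_subset_iff)
        show "Ck_on k V (\<lambda>y. frechet_derivative G (at (K y)) b)" for b
          by (rule Ck_on_compose[OF \<open>open V\<close> Suc Ck_on_SucD(2)[OF assms(2)] KV])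
      qed
    qed
  qed
  with UV that show thesis by blast
qed

section \<open>Smooth maps on arbitrary subsets\<close>

lemma smooth_onI:
  assumes "open W" "S \<subseteq> W" "\<And>k. Ck_on k W f"
  shows "smooth_on S f"
  unfolding smooth_on_def using assms by blast

lemma smooth_onE:
  assumes "smooth_on S f" "x \<in> S"
  obtains W h where "open W" "x \<in> W" "\<And>k. Ck_on k W h" "\<And>y. y \<in> S \<Longrightarrow> y \<in> W \<Longrightarrow> h y = f y"
  using bspec[OF assms(1)[unfolded smooth_on_def] assms(2)] by auto

lemma smooth_on_subset:
  assumes "smooth_on S f" "T \<subseteq> S"
  shows "smooth_on T f"
  unfolding smooth_on_def
proof
  fix x assume "x \<in> T"
  then have "x \<in> S" using assms(2) by blast
  with assms(1) obtain W h where "open W" "x \<in> W" "\<And>k. Ck_on k W h"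
    and "\<And>y. y \<in> S \<Longrightarrow> y \<in> W \<Longrightarrow> h y = f y"
    by (rule smooth_onE) blast
  with assms(2) show "\<exists>W h. open W \<and> x \<in> W \<and> (\<forall>k. Ck_on k W h) \<and> (\<forall>y\<in>T \<inter> W. h y = f y)"
    by (intro exI[of _ W] exI[of _ h]) auto
qed

lemma smooth_on_cong:
  assumes "\<And>x. x \<in> S \<Longrightarrow> f x = g x"
  shows "smooth_on S f \<longleftrightarrow> smooth_on S g"
  unfolding smooth_on_def using assms by simp

lemma smooth_on_compose:
  fixes f :: "'a::euclidean_space \<Rightarrow> 'b::euclidean_space" and g :: "'b \<Rightarrow> 'c::real_normed_vector"
  assumes "smooth_on S f" "smooth_on T g" "f ` S \<subseteq> T"
  shows "smooth_on S (g \<circ> f)"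
  unfolding smooth_on_def
proof
  fix x assume x: "x \<in> S"
  with assms(1) obtain W h where h: "open W" "x \<in> W" "\<And>k. Ck_on k W h"
    and hf: "\<And>y. y \<in> S \<Longrightarrow> y \<in> W \<Longrightarrow> h y = f y"
    by (rule smooth_onE) blast
  have "f x \<in> T" using x assms(3) by blast
  with assms(2) obtain W' h' where h': "open W'" "f x \<in> W'" "\<And>k. Ck_on k W' h'"
    and hg: "\<And>y. y \<in> T \<Longrightarrow> y \<in> W' \<Longrightarrow> h' y = g y"
    by (rule smooth_onE) blast
  let ?W = "W \<inter> h -` W'"
  have "open ?W"
    by (rule continuous_open_preimage[OF Ck_on_imp_continuous_on[OF h(3)] h(1) h'(1)])
  moreover have "x \<in> ?W"
    using x h(2) hf h'(2) by simp
  moreover have "Ck_on k ?W (\<lambda>x. h' (h x))" for k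
    by (rule Ck_on_compose[OF \<open>open ?W\<close> Ck_on_subset[OF h(3)] h'(3)]) auto
  moreover have "\<forall>y\<in>S \<inter> ?W. h' (h y) = (g \<circ> f) y"
    using hf hg assms(3) by auto
  ultimately show "\<exists>W h. open W \<and> x \<in> W \<and> (\<forall>k. Ck_on k W h) \<and> (\<forall>y\<in>S \<inter> W. h y = (g \<circ> f) y)"
    by blast
qed

lemma smooth_on_affine:
  assumes "linear A"
  shows "smooth_on S (\<lambda>x. a + A x)"
proof (rule smooth_onI[of UNIV])
  have "bounded_linear A" using assms by (simp add: linear_conv_bounded_linear)
  from Ck_on_bounded_linear[OF open_UNIV this Ck_on_id[OF open_UNIV]]
  show "Ck_on k UNIV (\<lambda>x. a + A x)" for k
    by (rule Ck_on_add[OF open_UNIV Ck_on_const[OF open_UNIV]])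
qed simp_all

lemma smooth_on_openD:
  assumes "smooth_on S f" "open S" "x \<in> S"
  shows "f differentiable (at x)" and "continuous_on S f"
proof -
  have ex: "f differentiable (at x)" if x: "x \<in> S" for x
  proof -
    obtain W h where h: "open W" "x \<in> W" "\<And>k. Ck_on k W h"
      and hf: "\<And>y. y \<in> S \<Longrightarrow> y \<in> W \<Longrightarrow> h y = f y"
      using smooth_onE[OF assms(1) x] by blast
    have "(f has_derivative frechet_derivative h (at x)) (at x)"
      by (rule has_derivative_transform_within_open[OF Ck_on_SucD(1)[OF h(3,2)], of "S \<inter> W"])
        (use h assms(2) x hf in auto)
    then show ?thesis
      unfolding differentiable_def by blast
  qed
  show "f differentiable (at x)" by (rule ex[OF \<open>x \<in> S\<close>])
  show "continuous_on S f"
    using ex by (auto simp: continuous_on_eq_continuous_at[OF assms(2)]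
        intro: differentiable_imp_continuous_within)
qed

section \<open>Velocities of curves in coordinates\<close>

lemma isCont_eventually_in_open:
  assumes "isCont c a" "open W" "c a \<in> W"
  shows "\<forall>\<^sub>F t in nhds a. c t \<in> W"
  using assms(1) unfolding isCont_def tendsto_at_iff_tendsto_nhds
  by (rule topological_tendstoD) (fact assms(2,3))+

text \<open>\<open>D\<close> is the derivative of a smooth extension of \<open>f\<close> near
  \<open>x\<close>, so one map serves all curves. \<open>S\<close> may have empty interior, but each
  curve stays in \<open>S\<close> near time \<open>0\<close>, and there the extension agrees with
  \<open>f\<close>.\<close>

lemma smooth_on_velocity:
  fixes f :: "'a::euclidean_space \<Rightarrow> 'b::real_normed_vector"
  assumes "smooth_on S f" "x \<in> S"
  obtains D where
    "\<And>c c'. c 0 = x \<Longrightarrow> (c has_vector_derivative c') (at 0) \<Longrightarrow> \<forall>\<^sub>F t in nhds 0. c t \<in> S \<Longrightarrow>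
      ((f \<circ> c) has_vector_derivative D c') (at 0)"
proof -
  obtain W h where h: "open W" "x \<in> W" "\<And>k. Ck_on k W h"
    and hf: "\<And>y. y \<in> S \<Longrightarrow> y \<in> W \<Longrightarrow> h y = f y"
    using smooth_onE[OF assms] by blast
  let ?D = "frechet_derivative h (at x)"
  have D: "(h has_derivative ?D) (at x)"
    by (rule Ck_on_SucD(1)[OF h(3,2)])
  show thesis
  proof (rule that)
    fix c c' assume c: "c 0 = x" "(c has_vector_derivative c') (at 0)" "\<forall>\<^sub>F t in nhds 0. c t \<in> S"
    have "isCont c 0"
      using c(2) by (rule has_vector_derivative_continuous)
    then have "\<forall>\<^sub>F t in nhds 0. c t \<in> W"
      by (rule isCont_eventually_in_open[OF _ h(1)]) (simp add: c(1) h(2))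
    with c(3) have "\<forall>\<^sub>F t in nhds 0. (h \<circ> c) t = (f \<circ> c) t"
      by eventually_elim (simp add: hf)
    then obtain J where J: "open J" "0 \<in> J" "\<And>t. t \<in> J \<Longrightarrow> (h \<circ> c) t = (f \<circ> c) t"
      unfolding eventually_nhds by blast
    have "(h has_derivative ?D) (at (c 0) within range c)"
      unfolding c(1) by (rule has_derivative_at_withinI[OF D])
    from vector_derivative_diff_chain_within[OF c(2) this]
    show "((f \<circ> c) has_vector_derivative ?D c') (at 0)"
      by (rule has_vector_derivative_transform_within_open[OF _ J])
  qed
qed

text \<open>The difference quotients lie in \<open>E\<close>, which is closed. As charts are valued
  in a possibly larger Euclidean type, this is what places coordinate velocities in the model
  space.\<close>

lemma has_vector_derivative_in_subspace:
  fixes c :: "real \<Rightarrow> 'a::euclidean_space"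
  assumes "(c has_vector_derivative c') (at 0)" "\<forall>\<^sub>F t in nhds 0. c t \<in> E" "subspace E"
  shows "c' \<in> E"
proof (rule Lim_in_closed_set)
  show "closed E" by (rule closed_subspace[OF assms(3)])
  show "((\<lambda>t. (c t - c 0) /\<^sub>R t) \<longlongrightarrow> c') (at 0)"
  proof -
    have "((\<lambda>t. (c t - c 0 - t *\<^sub>R c') /\<^sub>R \<bar>t\<bar>) \<longlongrightarrow> 0) (at 0)"
      using assms(1) by (simp add: has_vector_derivative_def has_derivative_at_within)
    then have "((\<lambda>t. norm ((c t - c 0 - t *\<^sub>R c') /\<^sub>R \<bar>t\<bar>)) \<longlongrightarrow> 0) (at 0)"
      by (rule tendsto_norm_zero)
    moreover have "norm ((c t - c 0 - t *\<^sub>R c') /\<^sub>R \<bar>t\<bar>) = norm ((c t - c 0) /\<^sub>R t - c')"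
      if "t \<noteq> 0" for t
    proof -
      have "(c t - c 0) /\<^sub>R t - c' = (c t - c 0 - t *\<^sub>R c') /\<^sub>R t"
        using that by (simp add: scaleR_diff_right)
      then show ?thesis by simp
    qed
    then have "\<forall>\<^sub>F t in at 0. norm ((c t - c 0 - t *\<^sub>R c') /\<^sub>R \<bar>t\<bar>) = norm ((c t - c 0) /\<^sub>R t - c')"
      unfolding eventually_at_filter by (intro always_eventually) blast
    ultimately have "((\<lambda>t. norm ((c t - c 0) /\<^sub>R t - c')) \<longlongrightarrow> 0) (at 0)"
      by (rule Lim_transform_eventually)
    then show ?thesis
      by (simp only: tendsto_norm_zero_iff LIM_zero_iff)
  qed
  have "c 0 \<in> E"
    using assms(2) by (rule eventually_nhds_x_imp_x)
  have "\<forall>\<^sub>F t in at 0. c t \<in> E"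
    using assms(2) by (auto simp: eventually_at_filter elim: eventually_mono)
  then show "\<forall>\<^sub>F t in at 0. (c t - c 0) /\<^sub>R t \<in> E"
    by eventually_elim (simp add: subspace_diff subspace_scale assms(3) \<open>c 0 \<in> E\<close>)
qed simp

section \<open>Charts and velocities of curves\<close>

lemma is_chartD:
  assumes "is_chart X E (U, \<phi>)"
  shows "openin X U" "openin (top_of_set E) (\<phi> ` U)"
    "homeomorphic_map (subtopology X U) (top_of_set (\<phi> ` U)) \<phi>" "inj_on \<phi> U" "\<phi> ` U \<subseteq> E"
proof -
  show X: "openin X U" and E: "openin (top_of_set E) (\<phi> ` U)"
    and h: "homeomorphic_map (subtopology X U) (top_of_set (\<phi> ` U)) \<phi>"
    using assms by (auto simp: is_chart_def)
  show "inj_on \<phi> U"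
    using homeomorphic_imp_injective_map[OF h] openin_subset[OF X] by (simp add: inf_absorb2)
  show "\<phi> ` U \<subseteq> E"
    using openin_imp_subset[OF E] .
qed

lemma is_chart_image_open:
  assumes c: "is_chart X E (U, \<phi>)" and V: "openin X V"
  shows "openin (top_of_set E) (\<phi> ` (U \<inter> V))"
proof -
  have "openin (subtopology X U) (U \<inter> V)"
    using V by (rule openin_subtopology_Int2)
  then have "openin (top_of_set (\<phi> ` U)) (\<phi> ` (U \<inter> V))"
    using homeomorphic_imp_open_map[OF is_chartD(3)[OF c]] by (simp add: open_map_def)
  then show ?thesis
    by (rule openin_trans) (rule is_chartD(2)[OF c])
qed

lemma is_chart_preimage_open:
  assumes c: "is_chart X E (U, \<phi>)" and Q: "open Q"
  shows "openin X {p \<in> U. \<phi> p \<in> Q}"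
proof -
  have "continuous_map (subtopology X U) (top_of_set (\<phi> ` U)) \<phi>"
    by (rule homeomorphic_imp_continuous_map[OF is_chartD(3)[OF c]])
  then have "openin (subtopology X U) {p \<in> topspace (subtopology X U). \<phi> p \<in> \<phi> ` U \<inter> Q}"
    by (rule openin_continuous_map_preimage) (rule openin_open_Int[OF Q])
  moreover have "{p \<in> topspace (subtopology X U). \<phi> p \<in> \<phi> ` U \<inter> Q} = {p \<in> U. \<phi> p \<in> Q}"
    using openin_subset[OF is_chartD(1)[OF c]] by auto
  ultimately show ?thesis
    using openin_trans_full is_chartD(1)[OF c] by metis
qed

lemma smooth_chartsD:
  assumes "c \<in> smooth_charts M"
  shows "is_chart (mtop M) (model M) c" "\<And>d. d \<in> atlas M \<Longrightarrow> compatible c d"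
  using assms by (auto simp: smooth_charts_def)

lemma compatibleD:
  assumes "compatible (U, \<phi>) (V, \<psi>)"
  shows "smooth_on (\<phi> ` (U \<inter> V)) (\<psi> \<circ> inv_into U \<phi>)"
    "smooth_on (\<psi> ` (U \<inter> V)) (\<phi> \<circ> inv_into V \<psi>)"
  using assms by (auto simp: compatible_def)

text \<open>Membership in \<open>curves_at\<close> gives smoothness in one unspecified chart
  \<open>\<psi>\<close>; the transition map carries it over to \<open>\<phi>\<close> for the times
  at which the curve lies in both domains.\<close>

lemma curve_in_chart:
  assumes \<gamma>: "\<gamma> \<in> curves_at M p" and U: "openin (mtop M) U" "p \<in> U"
    and compat: "\<And>V \<psi>. (V, \<psi>) \<in> smooth_charts M \<Longrightarrow> smooth_on (\<psi> ` (V \<inter> U)) (\<phi> \<circ> inv_into V \<psi>)"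
  obtains J where "open J" "0 \<in> J" "\<gamma> ` J \<subseteq> U" "smooth_on J (\<phi> \<circ> \<gamma>)"
proof -
  obtain V \<psi> e where c: "(V, \<psi>) \<in> smooth_charts M" and e: "e > 0"
    and V: "\<gamma> ` {-e<..<e} \<subseteq> V" and s: "smooth_on {-e<..<e} (\<psi> \<circ> \<gamma>)" and \<gamma>0: "\<gamma> 0 = p"
    using \<gamma> unfolding curves_at_def by auto
  note chart = smooth_chartsD(1)[OF c]
  have "openin (top_of_set (model M)) (\<psi> ` (V \<inter> U))"
    by (rule is_chart_image_open[OF chart U(1)])
  then obtain Q where Q: "open Q" "\<psi> ` (V \<inter> U) = model M \<inter> Q"
    by (auto simp: openin_open)
  \<comment> \<open>Continuity of the curve is available in the coordinates \<open>\<psi>\<close>,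
    so \<open>J\<close> is cut out by the open set \<open>Q\<close> of coordinates that represents
    \<open>V \<inter> U\<close>.\<close>
  define J where "J = {-e<..<e} \<inter> (\<psi> \<circ> \<gamma>) -` Q"
  have J: "\<gamma> t \<in> U \<and> \<gamma> t \<in> V" if "t \<in> J" for t
  proof -
    have t: "\<gamma> t \<in> V" "\<psi> (\<gamma> t) \<in> Q"
      using that V by (auto simp: J_def)
    then have "\<psi> (\<gamma> t) \<in> \<psi> ` (V \<inter> U)"
      using is_chartD(5)[OF chart] Q(2) by blast
    then show ?thesis
      using t(1) is_chartD(4)[OF chart] by (auto dest: inj_onD)
  qed
  show thesis
  proof
    show "open J"
      unfolding J_def
      by (rule continuous_open_preimage[OF smooth_on_openD(2)[OF s, of 0] _ Q(1)]) (use e in auto)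
    have "p \<in> V"
      using V \<gamma>0 e by (auto simp: image_subset_iff)
    then show "0 \<in> J"
      using Q(2) U(2) \<gamma>0 e by (auto simp: J_def)
    show "\<gamma> ` J \<subseteq> U"
      using J by blast
    have "smooth_on J ((\<phi> \<circ> inv_into V \<psi>) \<circ> (\<psi> \<circ> \<gamma>))"
      by (rule smooth_on_compose[OF smooth_on_subset[OF s] compat[OF c]]) (use J in \<open>auto simp: J_def\<close>)
    moreover have "((\<phi> \<circ> inv_into V \<psi>) \<circ> (\<psi> \<circ> \<gamma>)) t = (\<phi> \<circ> \<gamma>) t" if "t \<in> J" for t
      using J[OF that] is_chartD(4)[OF chart] by (simp add: inv_into_f_f)
    ultimately show "smooth_on J (\<phi> \<circ> \<gamma>)"
      using smooth_on_cong by (metis (no_types, lifting))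
  qed
qed

lemma atlas_curve:
  assumes "\<gamma> \<in> curves_at M p" "(U, \<phi>) \<in> atlas M" "openin (mtop M) W" "p \<in> W" "W \<subseteq> U"
  obtains J where "open J" "0 \<in> J" "\<gamma> ` J \<subseteq> W" "smooth_on J (\<phi> \<circ> \<gamma>)"
proof (rule curve_in_chart[OF assms(1,3,4)])
  show "smooth_on (\<psi> ` (V \<inter> W)) (\<phi> \<circ> inv_into V \<psi>)" if "(V, \<psi>) \<in> smooth_charts M" for V \<psi>
    by (rule smooth_on_subset[OF compatibleD(1)[OF smooth_chartsD(2)[OF that assms(2)]]])
      (use assms(5) in blast)
qed (rule that)

lemma atlas_curve_velocity:
  assumes "\<gamma> \<in> curves_at M p" "(U, \<phi>) \<in> atlas M" "openin (mtop M) W" "p \<in> W" "W \<subseteq> U"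
  shows "((\<phi> \<circ> \<gamma>) has_vector_derivative vector_derivative (\<phi> \<circ> \<gamma>) (at 0)) (at 0)"
    and "\<forall>\<^sub>F t in nhds 0. \<gamma> t \<in> W"
proof -
  obtain J where J: "open J" "0 \<in> J" "\<gamma> ` J \<subseteq> W" "smooth_on J (\<phi> \<circ> \<gamma>)"
    using atlas_curve[OF assms] by blast
  show "((\<phi> \<circ> \<gamma>) has_vector_derivative vector_derivative (\<phi> \<circ> \<gamma>) (at 0)) (at 0)"
    using smooth_on_openD(1)[OF J(4,1,2)] by (simp add: vector_derivative_works)
  show "\<forall>\<^sub>F t in nhds 0. \<gamma> t \<in> W"
    unfolding eventually_nhds using J by blast
qed

text \<open>\<open>D\<close> depends on \<open>f\<close> and \<open>p\<close> but not on the curve.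
  The conditions on \<open>U\<close> and \<open>\<phi>\<close> are assumed one by one, in place of
  \<open>smooth_manifold\<close>, so that bundle charts are covered as well.\<close>

lemma chart_change_velocity:
  assumes c: "(U, \<phi>) \<in> atlas M" and U: "openin (mtop M) U" "inj_on \<phi> U"
    and W: "openin (mtop M) W" "p \<in> W" "W \<subseteq> U" and f: "smooth_on (\<phi> ` W) (f \<circ> inv_into U \<phi>)"
  shows "\<exists>D. \<forall>\<gamma>\<in>curves_at M p.
    ((f \<circ> \<gamma>) has_vector_derivative D (vector_derivative (\<phi> \<circ> \<gamma>) (at 0))) (at 0)"
proof -
  have p: "p \<in> U" "\<phi> p \<in> \<phi> ` W" using W by auto
  obtain D where D: "\<And>c c'. c 0 = \<phi> p \<Longrightarrow> (c has_vector_derivative c') (at 0) \<Longrightarrow>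
      \<forall>\<^sub>F t in nhds 0. c t \<in> \<phi> ` W \<Longrightarrow>
      (((f \<circ> inv_into U \<phi>) \<circ> c) has_vector_derivative D c') (at 0)"
    using smooth_on_velocity[OF f p(2)] by blast
  show ?thesis
  proof (intro exI[of _ D] ballI)
    fix \<gamma> assume \<gamma>: "\<gamma> \<in> curves_at M p"
    note vel = atlas_curve_velocity[OF \<gamma> c W]
    have \<gamma>0: "\<gamma> 0 = p" using \<gamma> by (simp add: curves_at_def)
    have "\<forall>\<^sub>F t in nhds 0. (\<phi> \<circ> \<gamma>) t \<in> \<phi> ` W"
      using vel(2) by eventually_elim simp
    then have d: "(((f \<circ> inv_into U \<phi>) \<circ> (\<phi> \<circ> \<gamma>)) has_vector_derivative
        D (vector_derivative (\<phi> \<circ> \<gamma>) (at 0))) (at 0)"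
      using D[OF _ vel(1)] \<gamma>0 by simp
    obtain J where J: "open J" "0 \<in> J" "\<And>t. t \<in> J \<Longrightarrow> \<gamma> t \<in> W"
      using vel(2) unfolding eventually_nhds by blast
    show "((f \<circ> \<gamma>) has_vector_derivative D (vector_derivative (\<phi> \<circ> \<gamma>) (at 0))) (at 0)"
    proof (rule has_vector_derivative_transform_within_open[OF d J(1,2)])
      show "((f \<circ> inv_into U \<phi>) \<circ> (\<phi> \<circ> \<gamma>)) t = (f \<circ> \<gamma>) t" if "t \<in> J" for t
        using J(3)[OF that] W(3) U(2) by (simp add: inv_into_f_f subsetD)
    qed
  qed
qed

text \<open>\<open>velocity\<close> compares derivatives in all charts of the maximal atlas; each of
  these is a function of the derivative in the single chart \<open>\<phi>\<close>.\<close>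

lemma velocity_eqI:
  assumes \<gamma>: "\<gamma> \<in> curves_at M p" and \<delta>: "\<delta> \<in> curves_at M p"
    and c: "(U, \<phi>) \<in> atlas M" and U: "openin (mtop M) U" "inj_on \<phi> U" "p \<in> U"
    and eq: "vector_derivative (\<phi> \<circ> \<gamma>) (at 0) = vector_derivative (\<phi> \<circ> \<delta>) (at 0)"
  shows "velocity M \<gamma> = velocity M \<delta>"
proof -
  have "vector_derivative (\<psi> \<circ> \<gamma>) (at 0) = vector_derivative (\<psi> \<circ> \<delta>) (at 0)"
    if V: "(V, \<psi>) \<in> smooth_charts M" "p \<in> V" for V \<psi>
  proof -
    have "openin (mtop M) (V \<inter> U)"
      using is_chartD(1)[OF smooth_chartsD(1)[OF V(1)]] U(1) by blast
    moreover have "smooth_on (\<phi> ` (V \<inter> U)) (\<psi> \<circ> inv_into U \<phi>)"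
      by (rule compatibleD(2)[OF smooth_chartsD(2)[OF V(1) c]])
    ultimately obtain D where "\<forall>\<gamma>\<in>curves_at M p.
        ((\<psi> \<circ> \<gamma>) has_vector_derivative D (vector_derivative (\<phi> \<circ> \<gamma>) (at 0))) (at 0)"
      using chart_change_velocity[OF c U(1,2), of "V \<inter> U" p \<psi>] U(3) V(2) by auto
    from bspec[OF this \<gamma>] bspec[OF this \<delta>] show ?thesis
      by (simp add: eq vector_derivative_at)
  qed
  moreover have "\<gamma> 0 = p" "\<delta> 0 = p"
    using \<gamma> \<delta> by (simp_all add: curves_at_def)
  ultimately show ?thesis
    by (auto simp: velocity_def split_beta)
qed

section \<open>Representatives of tangent vectors and coordinate lines\<close>

lemma curve_in_velocity: "\<gamma> \<in> curves_at M p \<Longrightarrow> \<gamma> \<in> velocity M \<gamma>"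
  by (simp add: velocity_def) (simp add: curves_at_def)

text \<open>The Hilbert choices in \<open>tangent_coord\<close> and \<open>differential\<close> are
  harmless: the chosen representative is again a curve at \<open>p\<close> with the same derivative
  in every chart around \<open>p\<close>.\<close>

lemma some_in_velocity:
  assumes "\<gamma> \<in> curves_at M p"
  shows "(SOME \<delta>. \<delta> \<in> velocity M \<gamma>) \<in> curves_at M p"
    and "(U, \<phi>) \<in> smooth_charts M \<Longrightarrow> p \<in> U \<Longrightarrow>
      vector_derivative (\<phi> \<circ> (SOME \<delta>. \<delta> \<in> velocity M \<gamma>)) (at 0) = vector_derivative (\<phi> \<circ> \<gamma>) (at 0)"
proof -
  have "(SOME \<delta>. \<delta> \<in> velocity M \<gamma>) \<in> velocity M \<gamma>"
    using curve_in_velocity[OF assms] unfolding some_in_eq by blast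
  moreover have "\<gamma> 0 = p"
    using assms by (simp add: curves_at_def)
  ultimately show "(SOME \<delta>. \<delta> \<in> velocity M \<gamma>) \<in> curves_at M p"
    and "(U, \<phi>) \<in> smooth_charts M \<Longrightarrow> p \<in> U \<Longrightarrow>
      vector_derivative (\<phi> \<circ> (SOME \<delta>. \<delta> \<in> velocity M \<gamma>)) (at 0) = vector_derivative (\<phi> \<circ> \<gamma>) (at 0)"
    by (auto simp: velocity_def)
qed

lemma tangent_coord_velocity:
  assumes "\<gamma> \<in> curves_at M p" "(U, \<phi>) \<in> smooth_charts M" "p \<in> U"
  shows "tangent_coord \<phi> (velocity M \<gamma>) = vector_derivative (\<phi> \<circ> \<gamma>) (at 0)"
  unfolding tangent_coord_def by (rule some_in_velocity(2)[OF assms])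

lemma const_curve:
  assumes "(U, \<phi>) \<in> smooth_charts M" "p \<in> U"
  shows "(\<lambda>_. p) \<in> curves_at M p"
proof -
  have "smooth_on {-1<..<1::real} (\<phi> \<circ> (\<lambda>_. p))"
    by (rule smooth_onI[of UNIV]) (simp_all add: o_def Ck_on_const)
  with assms show ?thesis
    unfolding curves_at_def by (force intro!: bexI[of _ "(U, \<phi>)"] exI[of _ "1::real"])
qed

\<comment> \<open>The proof instantiates \<open>?d\<close> with \<open>u\<close>, so every model
  vector is the velocity of a curve. Such lines show that bundle charts fill the whole model fiber,
  and later serve as test curves tangent to \<open>N\<close>.\<close>
schematic_goal coordinate_line:
  assumes c: "(U, \<phi>) \<in> smooth_charts M" and p: "p \<in> U" and E: "subspace (model M)" "u \<in> model M"
  defines "\<gamma> \<equiv> \<lambda>t. inv_into U \<phi> (\<phi> p + t *\<^sub>R u)"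
  shows "\<gamma> \<in> curves_at M p" "((\<phi> \<circ> \<gamma>) has_vector_derivative ?d) (at 0)"
    "\<forall>\<^sub>F t in nhds 0. \<gamma> t \<in> U \<and> \<phi> (\<gamma> t) = \<phi> p + t *\<^sub>R u"
proof -
  note chart = is_chartD[OF smooth_chartsD(1)[OF c]]
  have p': "\<phi> p \<in> model M" using chart(5) p by blast
  obtain Q where Q: "open Q" "\<phi> ` U = model M \<inter> Q"
    using chart(2) by (auto simp: openin_open)
  have "open ((\<lambda>t. \<phi> p + t *\<^sub>R u) -` Q)"
    by (intro open_vimage Q continuous_intros)
  moreover have "0 \<in> (\<lambda>t. \<phi> p + t *\<^sub>R u) -` Q"
    using Q(2) p by auto
  ultimately obtain e where e: "e > 0" "ball 0 e \<subseteq> (\<lambda>t. \<phi> p + t *\<^sub>R u) -` Q"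
    using open_contains_ball by metis
  have U: "\<phi> p + t *\<^sub>R u \<in> \<phi> ` U" if "t \<in> {-e<..<e}" for t
  proof -
    have "t \<in> ball 0 e" using that by (auto simp: dist_real_def)
    with e(2) Q(2) E p' show ?thesis
      by (auto intro: subspace_add subspace_scale)
  qed
  have \<gamma>: "\<gamma> t \<in> U" "\<phi> (\<gamma> t) = \<phi> p + t *\<^sub>R u" if "t \<in> {-e<..<e}" for t
    using U[OF that] by (auto simp: \<gamma>_def inv_into_into f_inv_into_f)
  have J: "open {-e<..<e}" "0 \<in> {-e<..<e}" using e by auto
  have lin: "linear (\<lambda>t. t *\<^sub>R u)"
    by (intro linearI) (simp_all add: scaleR_add_left)
  have "smooth_on {-e<..<e} (\<phi> \<circ> \<gamma>)"
    by (subst smooth_on_cong[where g = "\<lambda>t. \<phi> p + t *\<^sub>R u"]) (simp_all add: \<gamma> smooth_on_affine[OF lin])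
  moreover have "\<gamma> 0 = p"
    using p chart(4) by (simp add: \<gamma>_def inv_into_f_f)
  ultimately show "\<gamma> \<in> curves_at M p"
    using c e(1) \<gamma>(1) unfolding curves_at_def
    by (auto intro!: bexI[of _ "(U, \<phi>)"] exI[of _ e])
  show "\<forall>\<^sub>F t in nhds 0. \<gamma> t \<in> U \<and> \<phi> (\<gamma> t) = \<phi> p + t *\<^sub>R u"
    unfolding eventually_nhds using J \<gamma> by blast
  have "((\<lambda>t. \<phi> p + t *\<^sub>R u) has_vector_derivative u) (at 0)"
    by (auto intro!: derivative_eq_intros)
  then show "((\<phi> \<circ> \<gamma>) has_vector_derivative u) (at 0)"
    by (rule has_vector_derivative_transform_within_open[OF _ J]) (simp add: \<gamma>)
qed

section \<open>Charts of the tangent bundle\<close>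

lemma smooth_manifoldD:
  assumes "smooth_manifold n M"
  shows "subspace (model M)" "\<And>c. c \<in> atlas M \<Longrightarrow> c \<in> smooth_charts M"
    "\<And>p. p \<in> topspace (mtop M) \<Longrightarrow> \<exists>(U, \<phi>)\<in>atlas M. p \<in> U"
proof -
  show "subspace (model M)" and "\<And>c. c \<in> atlas M \<Longrightarrow> c \<in> smooth_charts M"
    using assms by (auto simp: smooth_manifold_def smooth_charts_def)
  show "\<exists>(U, \<phi>)\<in>atlas M. p \<in> U" if "p \<in> topspace (mtop M)" for p
  proof -
    have "p \<in> (\<Union>c\<in>atlas M. fst c)"
      using assms that by (simp add: smooth_manifold_def)
    then show ?thesis by force
  qed
qed

lemma atlas_chartD:
  assumes "smooth_manifold n M" "(U, \<phi>) \<in> atlas M"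
  shows "(U, \<phi>) \<in> smooth_charts M" "is_chart (mtop M) (model M) (U, \<phi>)"
    "openin (mtop M) U" "inj_on \<phi> U" "\<phi> ` U \<subseteq> model M"
proof -
  show c: "(U, \<phi>) \<in> smooth_charts M"
    by (rule smooth_manifoldD(2)[OF assms])
  show "is_chart (mtop M) (model M) (U, \<phi>)" by (rule smooth_chartsD(1)[OF c])
  from is_chartD[OF this] show "openin (mtop M) U" "inj_on \<phi> U" "\<phi> ` U \<subseteq> model M" by auto
qed

abbreviation tangent_chart :: "('a \<Rightarrow> 'e::euclidean_space) \<Rightarrow> 'a \<times> 'a tangent_vector \<Rightarrow> 'e \<times> 'e" where
  "tangent_chart \<phi> \<equiv> \<lambda>(p, v). (\<phi> p, tangent_coord \<phi> v)"

abbreviation points_over ::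
  "('a, 'e::euclidean_space) manifold \<Rightarrow> 'a set \<Rightarrow> ('a \<times> 'a tangent_vector) set" where
  "points_over M U \<equiv> {z \<in> tangent_points M. bundle_proj z \<in> U}"

section \<open>Bundle charts and the topology they induce\<close>

lemma tangent_pointsE:
  assumes "(p, v) \<in> tangent_points M"
  obtains \<gamma> where "p \<in> topspace (mtop M)" "\<gamma> \<in> curves_at M p" "v = velocity M \<gamma>"
  using assms by (auto simp: tangent_points_def tangent_space_def)

lemma tangent_chart_image:
  assumes M: "smooth_manifold n M" and c: "(U, \<phi>) \<in> atlas M" and W: "W \<subseteq> U"
  shows "tangent_chart \<phi> ` points_over M W = \<phi> ` W \<times> model M"
proof (intro equalityI subsetI)
  note chart = atlas_chartD[OF M c]
  note E = smooth_manifoldD(1)[OF M]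
  fix y assume "y \<in> tangent_chart \<phi> ` points_over M W"
  then obtain p v where y: "y = (\<phi> p, tangent_coord \<phi> v)" and p: "p \<in> W" "(p, v) \<in> tangent_points M"
    by auto
  from p(2) obtain \<gamma> where "p \<in> topspace (mtop M)"
    and \<gamma>: "\<gamma> \<in> curves_at M p" and v: "v = velocity M \<gamma>"
    by (rule tangent_pointsE) (rule that)
  have pU: "p \<in> U" using p(1) W by blast
  note vel = atlas_curve_velocity[OF \<gamma> c chart(3) pU order_refl]
  have "\<forall>\<^sub>F t in nhds 0. (\<phi> \<circ> \<gamma>) t \<in> model M"
    using vel(2) by eventually_elim (use chart(5) in auto)
  from has_vector_derivative_in_subspace[OF vel(1) this E]
  have "tangent_coord \<phi> v \<in> model M"
    unfolding v tangent_coord_velocity[OF \<gamma> chart(1) pU] .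
  then show "y \<in> \<phi> ` W \<times> model M"
    using y p(1) by simp
next
  note chart = atlas_chartD[OF M c]
  fix y assume "y \<in> \<phi> ` W \<times> model M"
  then obtain p u where y: "y = (\<phi> p, u)" and p: "p \<in> W" and u: "u \<in> model M"
    by auto
  have pU: "p \<in> U" using p W by blast
  note line = coordinate_line[OF chart(1) pU smooth_manifoldD(1)[OF M] u]
  let ?v = "velocity M (\<lambda>t. inv_into U \<phi> (\<phi> p + t *\<^sub>R u))"
  have "tangent_coord \<phi> ?v = u"
    using tangent_coord_velocity[OF line(1) chart(1) pU] vector_derivative_at[OF line(2)] by simp
  moreover have "(p, ?v) \<in> points_over M W"
    using line(1) p pU openin_subset[OF chart(3)] by (auto simp: tangent_points_def tangent_space_def)
  ultimately show "y \<in> tangent_chart \<phi> ` points_over M W"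
    unfolding y by (intro image_eqI[of _ _ "(p, ?v)"]) simp_all
qed

lemma tangent_chart_inj_on:
  assumes M: "smooth_manifold n M" and c: "(U, \<phi>) \<in> atlas M"
  shows "inj_on (tangent_chart \<phi>) (points_over M U)"
proof (rule inj_onI)
  note chart = atlas_chartD[OF M c]
  fix y z assume y: "y \<in> points_over M U" and z: "z \<in> points_over M U"
    and eq: "tangent_chart \<phi> y = tangent_chart \<phi> z"
  obtain p v q w where yz: "y = (p, v)" "z = (q, w)" by (cases y, cases z)
  have pq: "p = q" "q \<in> U" "tangent_coord \<phi> v = tangent_coord \<phi> w"
    using eq y z chart(4) by (auto simp: yz dest: inj_onD)
  have "(q, v) \<in> tangent_points M" "(q, w) \<in> tangent_points M"
    using y z pq(1) by (simp_all add: yz)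
  then obtain \<gamma> \<delta> where curves: "\<gamma> \<in> curves_at M q" "\<delta> \<in> curves_at M q"
    and vw: "v = velocity M \<gamma>" "w = velocity M \<delta>"
    by (elim tangent_pointsE) blast
  have "v = w"
    unfolding vw
  proof (rule velocity_eqI[OF curves c chart(3,4) pq(2)])
    show "vector_derivative (\<phi> \<circ> \<gamma>) (at 0) = vector_derivative (\<phi> \<circ> \<delta>) (at 0)"
      using pq(3) by (simp add: vw tangent_coord_velocity[OF _ chart(1) pq(2)] curves)
  qed
  then show "y = z" by (simp add: yz pq)
qed

lemma tangent_bundle_simps [simp]:
  "model (tangent_bundle M) = model M \<times> model M"
  "atlas (tangent_bundle M) = bundle_chart M ` atlas M"
  by (simp_all add: tangent_bundle_def)

lemma bundle_chart_atlas:
  "(U, \<phi>) \<in> atlas M \<Longrightarrow> (points_over M U, tangent_chart \<phi>) \<in> atlas (tangent_bundle M)"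
  by (auto simp: bundle_chart_def intro!: image_eqI[of _ _ "(U, \<phi>)"])

text \<open>The constant \<open>topology\<close> can be unfolded only after its predicate is shown
  to be a topology. Injectivity of \<open>tangent_chart \<phi>\<close> is what makes images commute
  with intersections.\<close>

lemma openin_tangent_bundle:
  assumes M: "smooth_manifold n M"
  shows "openin (mtop (tangent_bundle M)) W \<longleftrightarrow> W \<subseteq> tangent_points M \<and>
    (\<forall>(U, \<phi>)\<in>atlas M.
      openin (top_of_set (model M \<times> model M)) (tangent_chart \<phi> ` (W \<inter> points_over M U)))"
proof -
  let ?P = "\<lambda>W. W \<subseteq> tangent_points M \<and>
    (\<forall>(U, \<phi>)\<in>atlas M.
      openin (top_of_set (model M \<times> model M)) (tangent_chart \<phi> ` (W \<inter> points_over M U)))"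
  have "istopology ?P"
    unfolding istopology_def
  proof (rule conjI; intro allI impI)
    fix S T assume S: "?P S" and T: "?P T"
    have "openin (top_of_set (model M \<times> model M)) (tangent_chart \<phi> ` (S \<inter> T \<inter> points_over M U))"
      if c: "(U, \<phi>) \<in> atlas M" for U \<phi>
    proof -
      have "tangent_chart \<phi> ` (S \<inter> T \<inter> points_over M U) =
          tangent_chart \<phi> ` ((S \<inter> points_over M U) \<inter> (T \<inter> points_over M U))"
        by (rule arg_cong[where f = "image _"]) blast
      also have "\<dots> = tangent_chart \<phi> ` (S \<inter> points_over M U) \<inter> tangent_chart \<phi> ` (T \<inter> points_over M U)"
        by (rule inj_on_image_Int[OF tangent_chart_inj_on[OF M c]]) auto
      finally show ?thesis
        using S T c by (auto intro!: openin_Int)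
    qed
    with S show "?P (S \<inter> T)" by blast
  next
    fix \<K> assume K: "\<forall>K\<in>\<K>. ?P K"
    have "openin (top_of_set (model M \<times> model M)) (tangent_chart \<phi> ` (\<Union>\<K> \<inter> points_over M U))"
      if c: "(U, \<phi>) \<in> atlas M" for U \<phi>
    proof -
      have "tangent_chart \<phi> ` (\<Union>\<K> \<inter> points_over M U) =
          \<Union>((\<lambda>K. tangent_chart \<phi> ` (K \<inter> points_over M U)) ` \<K>)"
        by blast
      then show ?thesis
        using K c by (auto intro!: openin_Union)
    qed
    with K show "?P (\<Union>\<K>)" by blast
  qed
  moreover have "mtop (tangent_bundle M) = topology ?P"
    by (simp add: tangent_bundle_def bundle_chart_def split_beta)
  ultimately show ?thesis
    by (simp only: topology_inverse')
qed

lemma points_over_open: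
  assumes M: "smooth_manifold n M" and W: "openin (mtop M) W"
  shows "openin (mtop (tangent_bundle M)) (points_over M W)"
  unfolding openin_tangent_bundle[OF M]
proof (intro conjI ballI)
  fix c assume "c \<in> atlas M"
  moreover obtain U \<phi> where c: "c = (U, \<phi>)" by (cases c)
  ultimately have U: "(U, \<phi>) \<in> atlas M" by simp
  have "points_over M W \<inter> points_over M U = points_over M (U \<inter> W)" by blast
  then have "tangent_chart \<phi> ` (points_over M W \<inter> points_over M U) = \<phi> ` (U \<inter> W) \<times> model M"
    using tangent_chart_image[OF M U, of "U \<inter> W"] by simp
  moreover have "openin (top_of_set (model M \<times> model M)) (\<phi> ` (U \<inter> W) \<times> model M)"
    by (intro openin_Times is_chart_image_open[OF atlas_chartD(2)[OF M U] W] openin_subtopology_self)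
  ultimately show "case c of (U, \<phi>) \<Rightarrow> openin (top_of_set (model M \<times> model M))
      (tangent_chart \<phi> ` (points_over M W \<inter> points_over M U))"
    by (simp add: c)
qed blast

section \<open>Submanifolds transverse to the fiber\<close>

text \<open>The term \<open>y - D (B y)\<close> supplies the directions missing from the image of
  \<open>L\<close> under \<open>D\<close> without a choice of complement: the derivative at
  \<open>0\<close> is \<open>D (B v) + (v - D (B v)) = v\<close>. The term vanishes for
  \<open>y = D u\<close> with \<open>u \<in> L\<close>, so there the straightened map is just
  \<open>f (a + B y)\<close>.\<close>

lemma smooth_immersion_straightening:
  fixes f :: "'b::euclidean_space \<Rightarrow> 'a::euclidean_space"
  assumes W: "open W" "a \<in> W" and f: "\<And>k. Ck_on k W f" and L: "subspace L"
    and D: "(f has_derivative D) (at a)" and inj: "inj_on D L"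
  obtains B Q R K where "linear B" "range B \<subseteq> L" "\<And>u. u \<in> L \<Longrightarrow> B (D u) = u"
    "open Q" "0 \<in> Q" "open R" "f a \<in> R" "\<And>y. y \<in> Q \<Longrightarrow> a + B y \<in> W"
    "homeomorphism Q R (\<lambda>y. f (a + B y) + (y - D (B y))) K"
    "\<And>k. Ck_on k Q (\<lambda>y. f (a + B y) + (y - D (B y)))" "\<And>k. Ck_on k R K"
proof -
  have linD: "linear D" by (rule has_derivative_linear[OF D])
  obtain B where B: "linear B" "range B \<subseteq> L" "\<And>u. u \<in> L \<Longrightarrow> B (D u) = u"
    using linear_exists_left_inverse_on[OF linD L inj] by blast
  have bB: "bounded_linear B" and bDB: "bounded_linear (\<lambda>y. y - D (B y))"
    using linear_compose[OF B(1) linD] B(1)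
    by (auto simp: linear_conv_bounded_linear o_def intro: bounded_linear_sub bounded_linear_ident)
  define Y where "Y = (\<lambda>y. a + B y) -` W"
  define G where "G y = f (a + B y) + (y - D (B y))" for y
  have "open Y"
    unfolding Y_def
    by (intro open_vimage W(1) continuous_intros linear_continuous_on bB)
  have Y0: "0 \<in> Y" by (simp add: Y_def W(2) linear_0[OF B(1)])
  have "Ck_on k Y (\<lambda>y. a + B y)" for k
    by (rule Ck_on_add[OF \<open>open Y\<close> Ck_on_const[OF \<open>open Y\<close>]
          Ck_on_bounded_linear[OF \<open>open Y\<close> bB Ck_on_id[OF \<open>open Y\<close>]]])
  then have "Ck_on k Y (\<lambda>y. f (a + B y))" for k
    by (rule Ck_on_compose[OF \<open>open Y\<close> _ f]) (auto simp: Y_def)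
  then have CkG: "Ck_on k Y G" for k
    unfolding G_def[abs_def]
    by (rule Ck_on_add[OF \<open>open Y\<close> _
          Ck_on_bounded_linear[OF \<open>open Y\<close> bDB Ck_on_id[OF \<open>open Y\<close>]]])
  have "((\<lambda>y. a + B y) has_derivative B) (at 0)"
    using has_derivative_add[OF has_derivative_const bounded_linear.has_derivative[OF bB has_derivative_ident]]
    by simp
  moreover have "(f has_derivative D) (at (a + B 0))"
    using D by (simp add: linear_0[OF B(1)])
  ultimately have "((\<lambda>y. f (a + B y)) has_derivative (\<lambda>v. D (B v))) (at 0)"
    by (rule has_derivative_compose)
  from has_derivative_add[OF this bounded_linear.has_derivative[OF bDB has_derivative_ident]]
  have "(G has_derivative (\<lambda>v. v)) (at 0)"
    by (simp add: G_def[abs_def])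
  then have "inj (frechet_derivative G (at 0))"
    by (simp flip: frechet_derivative_at)
  from smooth_inverse_function[OF \<open>open Y\<close> CkG Y0 this]
  obtain Q R K where Q: "open Q" "Q \<subseteq> Y" "0 \<in> Q" "open R" "G 0 \<in> R" "homeomorphism Q R G K"
    "\<And>k. Ck_on k R K"
    by blast
  show thesis
  proof (rule that[OF B Q(1,3,4) _ _ _ _ Q(7)])
    show "f a \<in> R"
      using Q(5) by (simp add: G_def linear_0[OF B(1)] linear_0[OF linD])
    show "a + B y \<in> W" if "y \<in> Q" for y
      using that Q(2) by (auto simp: Y_def)
    show "homeomorphism Q R (\<lambda>y. f (a + B y) + (y - D (B y))) K"
      using Q(6) by (simp add: G_def[abs_def])
    show "Ck_on k Q (\<lambda>y. f (a + B y) + (y - D (B y)))" for k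
      using Ck_on_subset[OF CkG Q(2)] by (simp add: G_def[abs_def])
  qed
qed

\<comment> \<open>\<open>G\<close> and \<open>K\<close> act on the ambient Euclidean type; the
  assumption \<open>model\<close> ensures that they restrict to the model space. The domain
  \<open>?U1\<close> is found to be \<open>{p \<in> U. \<phi> p \<in> R}\<close>.\<close>
schematic_goal smooth_chart_compose:
  assumes M: "smooth_manifold n M" and c: "(U, \<phi>) \<in> atlas M"
    and hom: "homeomorphism Q R G K" and open': "open Q" "open R"
    and Ck: "\<And>k. Ck_on k Q G" "\<And>k. Ck_on k R K"
    and model: "\<And>y. y \<in> Q \<Longrightarrow> G y \<in> model M \<longleftrightarrow> y \<in> model M"
  shows "(?U1, K \<circ> \<phi>) \<in> smooth_charts M"
proof -
  note chart = atlas_chartD[OF M c]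
  define U1 where "U1 = {p \<in> U. \<phi> p \<in> R}"
  define \<psi> where "\<psi> = K \<circ> \<phi>"
  have GK: "G (K y) = y" "K y \<in> Q" if "y \<in> R" for y
    using hom that by (auto simp: homeomorphism_def)
  have KG: "K (G y) = y" "G y \<in> R" if "y \<in> Q" for y
    using hom that by (auto simp: homeomorphism_def)
  have G\<psi>: "G (\<psi> p) = \<phi> p" "\<psi> p \<in> Q" "p \<in> U" if "p \<in> U1" for p
    using that GK by (auto simp: U1_def \<psi>_def)
  have inj: "inj_on \<psi> U1"
  proof (rule inj_onI)
    fix p q assume pq: "p \<in> U1" "q \<in> U1" "\<psi> p = \<psi> q"
    then have "\<phi> p = \<phi> q" by (simp flip: G\<psi>(1))
    then show "p = q" by (rule inj_onD[OF chart(4)]) (rule G\<psi>(3)[OF pq(1)] G\<psi>(3)[OF pq(2)])+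
  qed
  have "is_chart (mtop M) (model M) (U1, \<psi>)"
    unfolding is_chart_def prod.case
  proof (intro conjI)
    show "openin (mtop M) U1"
      unfolding U1_def by (rule is_chart_preimage_open[OF chart(2) open'(2)])
    obtain P where P: "open P" "\<phi> ` U = model M \<inter> P"
      using is_chartD(2)[OF chart(2)] by (auto simp: openin_open)
    \<comment> \<open>A model point \<open>y\<close> of \<open>Q\<close> is a value of
      \<open>\<psi>\<close> exactly when \<open>G y\<close>, again a model point, is a value of
      \<open>\<phi>\<close>, that is, when \<open>G y \<in> P\<close>.\<close>
    have "\<psi> ` U1 = model M \<inter> (Q \<inter> G -` P)"
    proof (intro equalityI subsetI)
      fix y assume "y \<in> \<psi> ` U1"
      then obtain p where p: "p \<in> U1" "y = \<psi> p" by blast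
      then have "G y \<in> model M \<inter> P" "y \<in> Q" using G\<psi>[of p] P(2) by auto
      then show "y \<in> model M \<inter> (Q \<inter> G -` P)" using model by blast
    next
      fix y assume y: "y \<in> model M \<inter> (Q \<inter> G -` P)"
      then have "G y \<in> \<phi> ` U" using model P(2) by blast
      then obtain p where p: "p \<in> U" "G y = \<phi> p" by blast
      then show "y \<in> \<psi> ` U1"
        using KG[of y] y by (auto simp: U1_def \<psi>_def image_iff intro!: exI[of _ p])
    qed
    moreover have "open (Q \<inter> G -` P)"
      by (rule continuous_open_preimage[OF Ck_on_imp_continuous_on[OF Ck(1)] open'(1) P(1)])
    ultimately show "openin (top_of_set (model M)) (\<psi> ` U1)"
      by (auto simp: openin_open)
    have "\<phi> ` (topspace (subtopology (mtop M) U) \<inter> U1) = topspace (top_of_set (\<phi> ` U)) \<inter> \<phi> ` U1"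
      using openin_subset[OF chart(3)] by (auto simp: U1_def)
    from homeomorphic_map_subtopologies[OF is_chartD(3)[OF chart(2)] this]
    have "homeomorphic_map (subtopology (mtop M) U1) (top_of_set (\<phi> ` U1)) \<phi>"
      by (simp add: subtopology_subtopology inf_absorb2 U1_def image_mono Collect_mono_iff
          subset_eq)
    moreover have "homeomorphism (\<phi> ` U1) (\<psi> ` U1) K G"
      by (rule homeomorphism_of_subsets[OF homeomorphism_symD[OF hom]])
        (auto simp: U1_def \<psi>_def GK)
    then have "homeomorphic_map (top_of_set (\<phi> ` U1)) (top_of_set (\<psi> ` U1)) K"
      unfolding homeomorphic_map_maps homeomorphic_maps_def
      by (intro exI[of _ G])
        (simp add: homeomorphism_def continuous_map_in_subtopology flip: image_subset_iff_funcset)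
    ultimately show "homeomorphic_map (subtopology (mtop M) U1) (top_of_set (\<psi> ` U1)) \<psi>"
      unfolding \<psi>_def by (rule homeomorphic_map_compose)
  qed
  moreover have "compatible (U1, \<psi>) d" if "d \<in> atlas M" for d
  proof -
    obtain V \<eta> where d: "d = (V, \<eta>)" by (cases d)
    with that have d': "(V, \<eta>) \<in> atlas M" by simp
    note chart' = atlas_chartD[OF M d']
    note compat = compatibleD[OF smooth_chartsD(2)[OF chart(1) d']]
    \<comment> \<open>Since \<open>\<phi> = G \<circ> \<psi>\<close> on \<open>U1\<close>, one
      transition map is the old one preceded by \<open>G\<close>; the other, below, is the old one
      followed by \<open>K\<close>.\<close>
    have "smooth_on (\<psi> ` (U1 \<inter> V)) ((\<eta> \<circ> inv_into U \<phi>) \<circ> G)"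
      by (rule smooth_on_compose[OF smooth_onI[OF open'(1) _ Ck(1)] compat(1)]) (auto simp: G\<psi>)
    moreover have "((\<eta> \<circ> inv_into U \<phi>) \<circ> G) y = (\<eta> \<circ> inv_into U1 \<psi>) y"
      if y: "y \<in> \<psi> ` (U1 \<inter> V)" for y
    proof -
      obtain p where p: "p \<in> U1" "y = \<psi> p" using y by blast
      then show ?thesis
        by (simp add: G\<psi> inv_into_f_f[OF inj] inv_into_f_f[OF chart(4)])
    qed
    ultimately have 1: "smooth_on (\<psi> ` (U1 \<inter> V)) (\<eta> \<circ> inv_into U1 \<psi>)"
      using smooth_on_cong by (metis (no_types, lifting))
    have "smooth_on (\<eta> ` (U1 \<inter> V)) (\<phi> \<circ> inv_into V \<eta>)"
      by (rule smooth_on_subset[OF compat(2)]) (auto simp: U1_def)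
    then have "smooth_on (\<eta> ` (U1 \<inter> V)) (K \<circ> (\<phi> \<circ> inv_into V \<eta>))"
    proof (rule smooth_on_compose[OF _ smooth_onI[OF open'(2) order_refl Ck(2)]])
      show "(\<phi> \<circ> inv_into V \<eta>) ` \<eta> ` (U1 \<inter> V) \<subseteq> R"
        by (auto simp: inv_into_f_f[OF chart'(4)]) (simp add: U1_def)
    qed
    with 1 show ?thesis
      by (simp add: d compatible_def \<psi>_def o_assoc)
  qed
  ultimately show "({p \<in> U. \<phi> p \<in> R}, K \<circ> \<phi>) \<in> smooth_charts M"
    by (simp add: smooth_charts_def flip: U1_def \<psi>_def)
qed

\<comment> \<open>A vector \<open>u\<close> of \<open>L\<close> killed by \<open>D\<close> is the
  coordinate velocity of a line in \<open>N\<close> whose projection to \<open>M\<close> has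
  velocity zero. The corresponding tangent vector is both tangent to \<open>N\<close> and vertical,
  hence zero by transversality, and so \<open>u = 0\<close>. The set \<open>?L\<close> becomes
  \<open>L\<close>.\<close>
schematic_goal transverse_projection_inj_on:
  assumes M: "smooth_manifold n M" and trans: "transverse_to_fiber_at M N z" and z: "z \<in> N"
    and \<phi>: "(U, \<phi>) \<in> atlas M" "bundle_proj z \<in> U" "z \<in> tangent_points M"
    and \<alpha>: "(A, \<alpha>) \<in> smooth_charts (tangent_bundle M)" "z \<in> A"
    and L: "subspace L" "L \<subseteq> model M \<times> model M" "\<alpha> ` (A \<inter> N) = \<alpha> ` A \<inter> L"
    and D: "\<And>\<gamma>. \<gamma> \<in> curves_at (tangent_bundle M) z \<Longrightarrow>
      ((\<phi> \<circ> bundle_proj \<circ> \<gamma>) has_vector_derivative D (vector_derivative (\<alpha> \<circ> \<gamma>) (at 0))) (at 0)"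
    and lin: "linear D"
  shows "inj_on D ?L"
proof -
  let ?TM = "tangent_bundle M" and ?x = "bundle_proj z"
  note chart = atlas_chartD[OF M \<phi>(1)]
  note chart' = is_chartD[OF smooth_chartsD(1)[OF \<alpha>(1)]]
  have E: "subspace (model M \<times> model M)"
    using smooth_manifoldD(1)[OF M] by (intro subspace_Times)
  have "u = 0" if u: "u \<in> L" "D u = 0" for u
  proof -
    define \<gamma> where "\<gamma> t = inv_into A \<alpha> (\<alpha> z + t *\<^sub>R u)" for t
    have line: "\<gamma> \<in> curves_at ?TM z" "((\<alpha> \<circ> \<gamma>) has_vector_derivative u) (at 0)"
        "\<forall>\<^sub>F t in nhds 0. \<gamma> t \<in> A \<and> \<alpha> (\<gamma> t) = \<alpha> z + t *\<^sub>R u"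
      using coordinate_line[OF \<alpha>, of u] E L(2) u(1) by (auto simp: \<gamma>_def[abs_def])
    have vd: "vector_derivative (\<alpha> \<circ> \<gamma>) (at 0) = u"
      by (rule vector_derivative_at[OF line(2)])
    have "\<alpha> z \<in> L" using L(3) \<alpha>(2) z by blast
    have "\<forall>\<^sub>F t in nhds 0. \<gamma> t \<in> N"
      using line(3)
    proof eventually_elim
      case (elim t)
      then have "\<alpha> (\<gamma> t) \<in> L"
        using L(1) \<open>\<alpha> z \<in> L\<close> u(1) by (simp add: subspace_add subspace_scale)
      then have "\<alpha> (\<gamma> t) \<in> \<alpha> ` A \<inter> L"
        using elim by blast
      then show ?case
        unfolding L(3)[symmetric] using elim inj_on_image_mem_iff[OF chart'(4), of "\<gamma> t" "A \<inter> N"]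
        by blast
    qed
    then have tangent: "velocity ?TM \<gamma> \<in> submanifold_tangent_space ?TM N z"
      using line(1) unfolding submanifold_tangent_space_def
      by (auto simp: eventually_at_filter elim: eventually_mono)
    \<comment> \<open>\<open>differential\<close> projects this chosen representative, not
      \<open>\<gamma>\<close>; the two share only their base point and first derivative, so the
      projected curve is analysed for \<open>\<delta>\<close>.\<close>
    define \<delta> where "\<delta> = (SOME \<delta>. \<delta> \<in> velocity ?TM \<gamma>)"
    have \<delta>: "\<delta> \<in> curves_at ?TM z" "vector_derivative (\<alpha> \<circ> \<delta>) (at 0) = u"
      using some_in_velocity[OF line(1)] \<alpha> vd by (auto simp: \<delta>_def)
    have "((\<phi> \<circ> (bundle_proj \<circ> \<delta>)) has_vector_derivative 0) (at 0)"
      using D[OF \<delta>(1)] u(2) \<delta>(2) by (simp add: o_assoc)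
    then have zero: "vector_derivative (\<phi> \<circ> (bundle_proj \<circ> \<delta>)) (at 0) = vector_derivative (\<phi> \<circ> (\<lambda>_. ?x)) (at 0)"
      by (simp add: vector_derivative_at o_def)
    obtain J where J: "open J" "0 \<in> J" "\<delta> ` J \<subseteq> points_over M U" "smooth_on J (tangent_chart \<phi> \<circ> \<delta>)"
      using atlas_curve[OF \<delta>(1) bundle_chart_atlas[OF \<phi>(1)] points_over_open[OF M chart(3)] _ order_refl]
        \<phi>(2,3) by blast
    obtain e where e: "e > 0" "ball 0 e \<subseteq> J"
      using J(1,2) open_contains_ball by metis
    have ball: "{-e<..<e} = ball 0 e" by (auto simp: dist_real_def)
    have "smooth_on J ((\<lambda>y. 0 + fst y) \<circ> (tangent_chart \<phi> \<circ> \<delta>))"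
      by (rule smooth_on_compose[OF J(4) smooth_on_affine]) (auto simp: linear_fst)
    then have "smooth_on J (\<phi> \<circ> (bundle_proj \<circ> \<delta>))"
      by (simp add: o_def split_beta)
    then have "smooth_on {-e<..<e} (\<phi> \<circ> (bundle_proj \<circ> \<delta>))"
      by (rule smooth_on_subset) (use e ball in simp)
    moreover have "(bundle_proj \<circ> \<delta>) ` {-e<..<e} \<subseteq> U"
      using J(3) e(2) unfolding ball by auto
    moreover have "(bundle_proj \<circ> \<delta>) 0 = ?x"
      using \<delta>(1) by (simp add: curves_at_def)
    ultimately have "bundle_proj \<circ> \<delta> \<in> curves_at M ?x"
      using chart(1) e(1) unfolding curves_at_def by (auto intro!: bexI[of _ "(U, \<phi>)"] exI[of _ e])
    from velocity_eqI[OF this const_curve[OF chart(1) \<phi>(2)] \<phi>(1) chart(3,4) \<phi>(2) zero]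
    have "differential M bundle_proj (velocity ?TM \<gamma>) = zero_tangent M ?x"
      by (simp add: differential_def zero_tangent_def flip: \<delta>_def)
    with line(1) have "velocity ?TM \<gamma> \<in> vertical_space M z"
      by (simp add: vertical_space_def tangent_space_def)
    with tangent trans have "velocity ?TM \<gamma> = velocity ?TM (\<lambda>_. z)"
      unfolding transverse_to_fiber_at_def zero_tangent_def by blast
    \<comment> \<open>Tangent vectors are sets of curves, so equality with the zero vector makes
      \<open>\<gamma>\<close> itself a member of the zero class, and its derivative in
      \<open>\<alpha>\<close> can be read off.\<close>
    with curve_in_velocity[OF line(1)] have "\<gamma> \<in> velocity ?TM (\<lambda>_. z)" by simp
    then have "vector_derivative (\<alpha> \<circ> \<gamma>) (at 0) = vector_derivative (\<alpha> \<circ> (\<lambda>_. z)) (at 0)"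
      using \<alpha> by (auto simp: velocity_def)
    moreover have "vector_derivative (\<alpha> \<circ> (\<lambda>_. z)) (at 0) = 0"
      by (simp add: o_def)
    ultimately show ?thesis
      by (simp add: vd)
  qed
  then show "inj_on D L"
    by (subst linear_injective_on_subspace_0[OF lin L(1)]) blast
qed

text \<open>\<open>\<alpha>\<close> belongs to the maximal atlas only, so the coordinate form of the
  projection comes from its transition to a bundle chart: \<open>f\<close> is the first component of
  a smooth extension of that transition to an open set of the ambient space.\<close>

lemma projection_in_slice_chart:
  fixes M :: "('a, 'e::euclidean_space) manifold"
  assumes M: "smooth_manifold n M" and \<phi>: "(U, \<phi>) \<in> atlas M" "bundle_proj z \<in> U"
    and \<alpha>: "(A, \<alpha>) \<in> smooth_charts (tangent_bundle M)" "z \<in> A" and z: "z \<in> tangent_points M"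
  obtains W f D where "open W" "\<alpha> z \<in> W" "\<And>k. Ck_on k W f" "(f has_derivative D) (at (\<alpha> z))"
    "W \<inter> (model M \<times> model M) \<subseteq> \<alpha> ` (A \<inter> points_over M U)"
    "\<And>w. w \<in> A \<Longrightarrow> w \<in> points_over M U \<Longrightarrow> \<alpha> w \<in> W \<Longrightarrow> f (\<alpha> w) = \<phi> (bundle_proj w)"
    "\<And>\<gamma>. \<gamma> \<in> curves_at (tangent_bundle M) z \<Longrightarrow>
      ((\<phi> \<circ> bundle_proj \<circ> \<gamma>) has_vector_derivative D (vector_derivative (\<alpha> \<circ> \<gamma>) (at 0))) (at 0)"
proof -
  let ?TM = "tangent_bundle M" and ?T = "points_over M U" and ?\<Phi> = "tangent_chart \<phi>"
  note chart = atlas_chartD[OF M \<phi>(1)]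
  note chart' = is_chartD[OF smooth_chartsD(1)[OF \<alpha>(1)]]
  note atlas = bundle_chart_atlas[OF \<phi>(1)]
  note openT = points_over_open[OF M chart(3)]
  note compat = compatibleD[OF smooth_chartsD(2)[OF \<alpha>(1) atlas]]
  have zT: "z \<in> ?T" using \<phi>(2) z by simp
  have "openin (top_of_set (model M \<times> model M)) (\<alpha> ` (A \<inter> ?T))"
    using is_chart_image_open[OF smooth_chartsD(1)[OF \<alpha>(1)] openT] by simp
  then obtain P where P: "open P" "\<alpha> ` (A \<inter> ?T) = (model M \<times> model M) \<inter> P"
    by (auto simp: openin_open)
  have az: "\<alpha> z \<in> \<alpha> ` (A \<inter> ?T)" using \<alpha>(2) zT by blast
  obtain W0 h where h: "open W0" "\<alpha> z \<in> W0" "\<And>k. Ck_on k W0 h"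
    "\<And>y. y \<in> \<alpha> ` (A \<inter> ?T) \<Longrightarrow> y \<in> W0 \<Longrightarrow> h y = (?\<Phi> \<circ> inv_into A \<alpha>) y"
    using smooth_onE[OF compat(1) az] by blast
  \<comment> \<open>\<open>W0\<close> carries the extension; intersecting with \<open>P\<close>
    makes every model point of \<open>W\<close> the coordinate of a point of \<open>A\<close> over
    \<open>U\<close>.\<close>
  define W where "W = W0 \<inter> P"
  define f where "f y = fst (h y)" for y
  have W: "open W" "\<alpha> z \<in> W"
    using h(1,2) P az by (auto simp: W_def)
  have Ck: "Ck_on k W f" for k
    unfolding f_def[abs_def]
    by (rule Ck_on_bounded_linear[OF W(1) bounded_linear_fst Ck_on_subset[OF h(3)]])
      (simp add: W_def)
  have f: "f (\<alpha> w) = \<phi> (bundle_proj w)" if "w \<in> A" "w \<in> ?T" "\<alpha> w \<in> W" for w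
  proof -
    have "h (\<alpha> w) = ?\<Phi> w"
      using h(4)[of "\<alpha> w"] that by (simp add: W_def inv_into_f_f[OF chart'(4)])
    then show ?thesis by (simp add: f_def split_beta)
  qed
  let ?D = "frechet_derivative f (at (\<alpha> z))"
  have D: "(f has_derivative ?D) (at (\<alpha> z))"
    by (rule Ck_on_SucD(1)[OF Ck W(2)])
  have vel: "((\<phi> \<circ> bundle_proj \<circ> \<gamma>) has_vector_derivative ?D (vector_derivative (\<alpha> \<circ> \<gamma>) (at 0))) (at 0)"
    if \<gamma>: "\<gamma> \<in> curves_at ?TM z" for \<gamma>
  proof -
    have \<gamma>0: "\<gamma> 0 = z" using \<gamma> by (simp add: curves_at_def)
    have AT: "openin (mtop ?TM) (A \<inter> ?T)" "z \<in> A \<inter> ?T" "A \<inter> ?T \<subseteq> ?T"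
      using chart'(1) openT \<alpha>(2) zT by auto
    \<comment> \<open>\<open>D1\<close> serves only to show that
      \<open>\<alpha> \<circ> \<gamma>\<close> is differentiable at \<open>0\<close>, by passing
      through the bundle chart.\<close>
    obtain D1 where "\<forall>\<gamma>\<in>curves_at ?TM z.
        ((\<alpha> \<circ> \<gamma>) has_vector_derivative D1 (vector_derivative (?\<Phi> \<circ> \<gamma>) (at 0))) (at 0)"
      using chart_change_velocity[OF atlas openT tangent_chart_inj_on[OF M \<phi>(1)] AT compat(2)] ..
    from bspec[OF this \<gamma>] have \<alpha>\<gamma>: "((\<alpha> \<circ> \<gamma>) has_vector_derivative vector_derivative (\<alpha> \<circ> \<gamma>) (at 0)) (at 0)"
      by (simp add: vector_derivative_at)
    have "isCont (\<alpha> \<circ> \<gamma>) 0"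
      using \<alpha>\<gamma> by (rule has_vector_derivative_continuous)
    then have "\<forall>\<^sub>F t in nhds 0. (\<alpha> \<circ> \<gamma>) t \<in> W"
      by (rule isCont_eventually_in_open[OF _ W(1)]) (simp add: \<gamma>0 W(2))
    moreover have "\<forall>\<^sub>F t in nhds 0. \<gamma> t \<in> A \<inter> ?T"
      by (rule atlas_curve_velocity(2)[OF \<gamma> atlas AT])
    ultimately have "\<forall>\<^sub>F t in nhds 0. (f \<circ> (\<alpha> \<circ> \<gamma>)) t = (\<phi> \<circ> bundle_proj \<circ> \<gamma>) t"
      by eventually_elim (simp add: f)
    then obtain J where J: "open J" "0 \<in> J"
      "\<And>t. t \<in> J \<Longrightarrow> (f \<circ> (\<alpha> \<circ> \<gamma>)) t = (\<phi> \<circ> bundle_proj \<circ> \<gamma>) t"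
      unfolding eventually_nhds by blast
    have "(f has_derivative ?D) (at ((\<alpha> \<circ> \<gamma>) 0) within range (\<alpha> \<circ> \<gamma>))"
      using D \<gamma>0 by (simp add: has_derivative_at_withinI)
    from vector_derivative_diff_chain_within[OF \<alpha>\<gamma> this]
    show ?thesis
      by (rule has_vector_derivative_transform_within_open[OF _ J])
  qed
  show thesis
    by (rule that[OF W Ck D _ f vel]) (use P(2) in \<open>auto simp: W_def\<close>)
qed

\<comment> \<open>The dimension \<open>?k\<close> is resolved to \<open>l\<close>: the slice is
  modelled on the image of \<open>L\<close> under \<open>D\<close>, and \<open>D\<close> is
  injective on \<open>L\<close>.\<close>
schematic_goal transverse_submanifold_is_local_field:
  fixes M :: "('a, 'e::euclidean_space) manifold"
    and N :: "('a \<times> 'a tangent_vector) set"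
    and z :: "'a \<times> 'a tangent_vector"
    and n l :: nat
  assumes "smooth_manifold n M"
    and "embedded_submanifold l (tangent_bundle M) N"
    and "z \<in> N"
    and "transverse_to_fiber_at M N z"
  shows "\<exists>F U V \<xi>.
    embedded_submanifold ?k M F \<and> bundle_proj z \<in> F \<and>
    openin (mtop M) U \<and> bundle_proj z \<in> U \<and>
    openin (mtop (tangent_bundle M)) V \<and> z \<in> V \<and>
    vector_field_along M (F \<inter> U) \<xi> \<and>
    N \<inter> V = \<xi> ` (F \<inter> U)"
proof -
  note M = assms(1)
  let ?TM = "tangent_bundle M" and ?E = "model M"
  note E = smooth_manifoldD(1)[OF M]
  obtain A \<alpha> L where \<alpha>: "(A, \<alpha>) \<in> smooth_charts ?TM" "z \<in> A"
    and L: "subspace L" "L \<subseteq> ?E \<times> ?E" "dim L = l" "\<alpha> ` (A \<inter> N) = \<alpha> ` A \<inter> L"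
    using assms(2,3) unfolding embedded_submanifold_def by auto
  note chart' = is_chartD[OF smooth_chartsD(1)[OF \<alpha>(1)]]
  have z: "z \<in> tangent_points M"
    using chart'(1) \<alpha>(2) by (auto simp: openin_tangent_bundle[OF M])
  then have "bundle_proj z \<in> topspace (mtop M)"
    by (auto simp: tangent_points_def)
  then obtain U \<phi> where \<phi>: "(U, \<phi>) \<in> atlas M" "bundle_proj z \<in> U"
    using smooth_manifoldD(3)[OF M] by blast
  note chart = atlas_chartD[OF M \<phi>(1)]
  let ?T = "points_over M U" and ?a = "\<alpha> z"
  obtain W f D where W: "open W" "?a \<in> W" and Ckf: "\<And>k. Ck_on k W f"
    and D: "(f has_derivative D) (at ?a)"
    and W_image: "W \<inter> (?E \<times> ?E) \<subseteq> \<alpha> ` (A \<inter> ?T)"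
    and f: "\<And>w. w \<in> A \<Longrightarrow> w \<in> ?T \<Longrightarrow> \<alpha> w \<in> W \<Longrightarrow> f (\<alpha> w) = \<phi> (bundle_proj w)"
    and vel: "\<And>\<gamma>. \<gamma> \<in> curves_at ?TM z \<Longrightarrow>
      ((\<phi> \<circ> bundle_proj \<circ> \<gamma>) has_vector_derivative D (vector_derivative (\<alpha> \<circ> \<gamma>) (at 0))) (at 0)"
    by (rule projection_in_slice_chart[OF M \<phi> \<alpha> z]) (rule that, blast+)
  have linD: "linear D" by (rule has_derivative_linear[OF D])
  have inj: "inj_on D L"
    by (rule transverse_projection_inj_on[OF M assms(4,3) \<phi> z \<alpha> L(1,2,4) vel linD])
  have aL: "?a \<in> L" using L(4) \<alpha>(2) assms(3) by blast
  \<comment> \<open>\<open>D\<close> differentiates an ambient extension, but along \<open>L\<close>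
    it computes velocities of projected curves in the chart \<open>\<phi>\<close>, and these lie in
    the model space.\<close>
  have DL: "D u \<in> ?E" if "u \<in> L" for u
  proof (rule has_vector_derivative_in_subspace[OF _ _ E])
    have "subspace (model ?TM)" "u \<in> model ?TM"
      using E L(2) that by (auto intro: subspace_Times)
    note line = coordinate_line[OF \<alpha> this]
    let ?\<gamma> = "\<lambda>t. inv_into A \<alpha> (\<alpha> z + t *\<^sub>R u)"
    show "((\<phi> \<circ> bundle_proj \<circ> ?\<gamma>) has_vector_derivative D u) (at 0)"
      using vel[OF line(1)] vector_derivative_at[OF line(2)] by simp
    have "\<forall>\<^sub>F t in nhds 0. ?\<gamma> t \<in> ?T"
      by (rule atlas_curve_velocity(2)[OF line(1) bundle_chart_atlas[OF \<phi>(1)]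
            points_over_open[OF M chart(3)]]) (use z \<phi>(2) in auto)
    then show "\<forall>\<^sub>F t in nhds 0. (\<phi> \<circ> bundle_proj \<circ> ?\<gamma>) t \<in> ?E"
      by eventually_elim (use chart(5) in auto)
  qed
  obtain B Q R K where hom: "homeomorphism Q R (\<lambda>y. f (?a + B y) + (y - D (B y))) K"
    and B: "linear B" "range B \<subseteq> L" "\<And>u. u \<in> L \<Longrightarrow> B (D u) = u"
    and Q: "open Q" "0 \<in> Q" "open R" "f ?a \<in> R" "\<And>y. y \<in> Q \<Longrightarrow> ?a + B y \<in> W"
    and Ck: "\<And>k. Ck_on k Q (\<lambda>y. f (?a + B y) + (y - D (B y)))" "\<And>k. Ck_on k R K"
    by (rule smooth_immersion_straightening[OF W Ckf L(1) D inj])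
      (rule that, assumption, (assumption | blast)+)
  define G where "G y = f (?a + B y) + (y - D (B y))" for y
  have KG: "K (G y) = y" "G y \<in> R" if "y \<in> Q" for y
    using hom that by (auto simp: homeomorphism_def G_def)
  have GK: "G (K y) = y" "K y \<in> Q" if "y \<in> R" for y
    using hom that by (auto simp: homeomorphism_def G_def)
  \<comment> \<open>As \<open>B\<close> takes values in \<open>L\<close>, the point
    \<open>?a + B y\<close> stays in the slice and in \<open>W\<close>; hence it is the coordinate
    of a point of \<open>N\<close> over \<open>U\<close>, where \<open>f\<close> expresses the
    projection.\<close>
  have lift: "\<exists>w. w \<in> A \<and> w \<in> ?T \<and> w \<in> N \<and> \<alpha> w = ?a + B y \<and> f (?a + B y) = \<phi> (bundle_proj w)"
    if y: "y \<in> Q" for y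
  proof -
    have aB: "?a + B y \<in> L"
      using aL B(2) L(1) by (auto intro: subspace_add)
    with Q(5)[OF y] L(2) W_image have "?a + B y \<in> \<alpha> ` (A \<inter> ?T)"
      by blast
    then obtain w where w: "w \<in> A" "w \<in> ?T" "\<alpha> w = ?a + B y"
      by force
    moreover have "\<alpha> w \<in> \<alpha> ` (A \<inter> N)"
      unfolding L(4) using aB w(3) imageI[OF w(1), of \<alpha>] by simp
    then have "w \<in> N"
      using inj_on_image_mem_iff[OF chart'(4) w(1), of "A \<inter> N"] by blast
    moreover have "f (?a + B y) = \<phi> (bundle_proj w)"
      using f[OF w(1,2)] w(3) Q(5)[OF y] by simp
    ultimately show ?thesis by blast
  qed
  \<comment> \<open>\<open>G y\<close> and \<open>y\<close> differ by
    \<open>f (?a + B y) - D (B y)\<close>, a difference of two model vectors.\<close>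
  have model: "G y \<in> ?E \<longleftrightarrow> y \<in> ?E" if y: "y \<in> Q" for y
  proof -
    have "f (?a + B y) - D (B y) \<in> ?E"
      using lift[OF y] chart(5) DL[of "B y"] B(2) E by (auto intro!: subspace_diff)
    moreover have "G y = (f (?a + B y) - D (B y)) + y" "y = G y - (f (?a + B y) - D (B y))"
      by (simp_all add: G_def)
    ultimately show ?thesis
      using subspace_add[OF E] subspace_diff[OF E] by metis
  qed
  define U1 where "U1 = {p \<in> U. \<phi> p \<in> R}"
  define \<psi> where "\<psi> = K \<circ> \<phi>"
  have \<psi>: "(U1, \<psi>) \<in> smooth_charts M"
    unfolding U1_def \<psi>_def
    by (rule smooth_chart_compose[OF M \<phi>(1) hom Q(1,3) Ck]) (use model in \<open>simp add: G_def\<close>)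
  note chart1 = is_chartD[OF smooth_chartsD(1)[OF \<psi>]]
  have U1: "p \<in> U" "\<psi> p \<in> Q" "G (\<psi> p) = \<phi> p" if "p \<in> U1" for p
    using that GK by (auto simp: U1_def \<psi>_def)
  define F where "F = {p \<in> U1. \<psi> p \<in> D ` L}"
  define \<xi> where "\<xi> p = inv_into A \<alpha> (?a + B (\<psi> p))" for p
  \<comment> \<open>For \<open>w\<close> in \<open>N\<close> near \<open>z\<close>,
    \<open>y = D (\<alpha> w - ?a)\<close> is the parameter with
    \<open>?a + B y = \<alpha> w\<close>. Requiring \<open>y \<in> Q\<close> keeps it in the range
    of \<open>\<psi>\<close>, and the condition is open because it is posed on all of
    \<open>A \<inter> ?T\<close>.\<close>
  define V where "V = {w \<in> A \<inter> ?T. D (\<alpha> w - ?a) \<in> Q}"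
  have DB: "D (B y) = y" if "y \<in> D ` L" for y
    using that B(3) by auto
  have \<xi>: "\<xi> p \<in> A" "\<xi> p \<in> ?T" "\<xi> p \<in> N" "\<alpha> (\<xi> p) = ?a + B (\<psi> p)" "bundle_proj (\<xi> p) = p"
    if p: "p \<in> F" for p
  proof -
    have p1: "p \<in> U1" and pL: "\<psi> p \<in> D ` L" using p by (auto simp: F_def)
    obtain w where w: "w \<in> A" "w \<in> ?T" "w \<in> N" "\<alpha> w = ?a + B (\<psi> p)"
      "f (?a + B (\<psi> p)) = \<phi> (bundle_proj w)"
      using lift[OF U1(2)[OF p1]] by blast
    have \<xi>w: "\<xi> p = w"
      unfolding \<xi>_def w(4)[symmetric] by (rule inv_into_f_f[OF chart'(4) w(1)])
    then show "\<xi> p \<in> A" "\<xi> p \<in> ?T" "\<xi> p \<in> N" "\<alpha> (\<xi> p) = ?a + B (\<psi> p)"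
      using w by simp_all
    \<comment> \<open>On the image of \<open>L\<close> under \<open>D\<close> the correction term of
      \<open>G\<close> vanishes, so \<open>\<phi> p = G (\<psi> p)\<close> is the projection of the
      lifted point.\<close>
    have "\<phi> (bundle_proj w) = \<phi> p"
      using U1(3)[OF p1] w(5) DB[OF pL] by (simp add: G_def)
    then show "bundle_proj (\<xi> p) = p"
      using w(2) U1(1)[OF p1] chart(4) unfolding \<xi>w by (auto dest: inj_onD)
  qed
  have F: "embedded_submanifold l M F"
    unfolding embedded_submanifold_def
  proof (intro conjI ballI)
    show "F \<subseteq> topspace (mtop M)"
      using openin_subset[OF chart1(1)] by (auto simp: F_def)
    have "subspace (D ` L)" "D ` L \<subseteq> ?E" "dim (D ` L) = l"
      using L(1,3) linear_subspace_image[OF linD] DL dim_image_eq[OF linD, of L] inj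
      by (auto simp: span_eq_iff[THEN iffD2])
    moreover have "\<psi> ` (U1 \<inter> F) = \<psi> ` U1 \<inter> D ` L"
      by (auto simp: F_def)
    ultimately show "\<exists>(U, \<phi>)\<in>smooth_charts M. p \<in> U \<and>
        (\<exists>L. subspace L \<and> L \<subseteq> ?E \<and> dim L = l \<and> \<phi> ` (U \<inter> F) = \<phi> ` U \<inter> L)" if "p \<in> F" for p
      using \<psi> that by (intro bexI[of _ "(U1, \<psi>)"]) (auto simp: F_def)
  qed
  \<comment> \<open>Together with \<open>G 0 = f ?a\<close> this gives
    \<open>\<psi> (bundle_proj z) = 0\<close>, which lies in the image of \<open>L\<close>.\<close>
  have "f ?a = \<phi> (bundle_proj z)"
    using f[OF \<alpha>(2)] z \<phi>(2) W(2) by simp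
  moreover have "G 0 = f ?a"
    by (simp add: G_def linear_0[OF B(1)] linear_0[OF linD])
  ultimately have xF: "bundle_proj z \<in> F"
    using Q(2,4) \<phi>(2) KG[OF Q(2)] subspace_0[OF L(1)] linear_0[OF linD]
    by (auto simp: F_def U1_def \<psi>_def image_iff intro!: bexI[of _ 0])
  have "openin (mtop ?TM) ({w \<in> A. \<alpha> w \<in> (\<lambda>y. D (y - ?a)) -` Q} \<inter> ?T)"
  proof (intro openin_Int is_chart_preimage_open[OF smooth_chartsD(1)[OF \<alpha>(1)]]
      points_over_open[OF M chart(3)] open_vimage Q(1))
    show "continuous_on UNIV (\<lambda>y. D (y - ?a))"
      by (intro linear_continuous_on_compose[OF _ linD] continuous_intros)
  qed
  moreover have "{w \<in> A. \<alpha> w \<in> (\<lambda>y. D (y - ?a)) -` Q} \<inter> ?T = V"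
    by (auto simp: V_def)
  ultimately have openV: "openin (mtop ?TM) V" by simp
  have zV: "z \<in> V"
    using \<alpha>(2) z \<phi>(2) Q(2) by (simp add: V_def linear_0[OF linD])
  have "vector_field_along M F \<xi>"
    unfolding vector_field_along_def
  proof (intro conjI ballI)
    have "smooth_on (\<psi> ` (F \<inter> U1)) (\<alpha> \<circ> \<xi> \<circ> inv_into U1 \<psi>)"
    proof (subst smooth_on_cong)
      show "(\<alpha> \<circ> \<xi> \<circ> inv_into U1 \<psi>) y = ?a + B y" if y: "y \<in> \<psi> ` (F \<inter> U1)" for y
        using y \<xi>(4) by (auto simp: inv_into_f_f[OF chart1(4)])
    qed (rule smooth_on_affine[OF B(1)])
    moreover have "\<xi> ` (F \<inter> U1) \<subseteq> A" using \<xi>(1) by blast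
    ultimately show "smooth_map_on M ?TM F \<xi>"
      unfolding smooth_map_on_def
      using \<psi> \<alpha>(1) by (intro ballI bexI[of _ "(U1, \<psi>)"]) (auto simp: F_def)
    show "\<xi> p \<in> tangent_points M" "bundle_proj (\<xi> p) = p" if "p \<in> F" for p
      using \<xi>(2,5)[OF that] by simp_all
  qed
  moreover have "N \<inter> V = \<xi> ` F"
  proof (intro equalityI subsetI)
    fix w assume "w \<in> N \<inter> V"
    then have w: "w \<in> N" "w \<in> A" "w \<in> ?T" "D (\<alpha> w - ?a) \<in> Q"
      by (auto simp: V_def)
    have u: "\<alpha> w - ?a \<in> L"
      using L(1,4) aL w(1,2) by (auto intro: subspace_diff)
    define y where "y = D (\<alpha> w - ?a)"
    have aB: "?a + B y = \<alpha> w" "D (B y) = y"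
      using B(3)[OF u] by (simp_all add: y_def)
    \<comment> \<open>The correction term vanishes at \<open>y\<close>, so applying \<open>K\<close>
      identifies \<open>y\<close> as \<open>\<psi> (bundle_proj w)\<close>. Thus \<open>w\<close>
      lies over \<open>F\<close>, and \<open>\<xi>\<close> returns \<open>w\<close> there.\<close>
    have "G y = \<phi> (bundle_proj w)"
      using f[OF w(2,3)] Q(5)[of y] w(4) aB by (simp add: G_def y_def[symmetric])
    then have w': "bundle_proj w \<in> U1" "\<psi> (bundle_proj w) = y"
      using KG[of y] w(3,4) by (auto simp: U1_def \<psi>_def y_def[symmetric])
    have "bundle_proj w \<in> F"
      using w' imageI[OF u, of D] by (simp add: F_def y_def)
    moreover have "\<xi> (bundle_proj w) = w"
      by (simp add: \<xi>_def w'(2) aB(1) inv_into_f_f[OF chart'(4) w(2)])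
    ultimately show "w \<in> \<xi> ` F" by force
  next
    fix w assume "w \<in> \<xi> ` F"
    then obtain p where p: "p \<in> F" "w = \<xi> p" by blast
    have "D (B (\<psi> p)) \<in> Q"
      using p(1) DB U1(2) by (auto simp: F_def)
    with \<xi>[OF p(1)] show "w \<in> N \<inter> V"
      by (auto simp: p(2) V_def)
  qed
  moreover have "F \<inter> U1 = F" by (auto simp: F_def)
  moreover have "bundle_proj z \<in> U1" using xF by (simp add: F_def)
  ultimately show "\<exists>F U V \<xi>.
    embedded_submanifold l M F \<and> bundle_proj z \<in> F \<and>
    openin (mtop M) U \<and> bundle_proj z \<in> U \<and>
    openin (mtop (tangent_bundle M)) V \<and> z \<in> V \<and>
    vector_field_along M (F \<inter> U) \<xi> \<and>
    N \<inter> V = \<xi> ` (F \<inter> U)"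
    using F xF chart1(1) openV zV
    by (intro exI[of _ F] exI[of _ U1] exI[of _ V] exI[of _ \<xi>]) simp
qed

theorem proposition2p1:
  fixes M :: "('a, 'e::euclidean_space) manifold"
    and g :: "'a \<Rightarrow> 'a tangent_vector \<Rightarrow> 'a tangent_vector \<Rightarrow> real"
    and N :: "('a \<times> 'a tangent_vector) set"
    and z :: "'a \<times> 'a tangent_vector"
    and n l :: nat
  assumes "smooth_manifold n M"
    and "riemannian_metric M g"
    and "embedded_submanifold l (tangent_bundle M) N"
    and "z \<in> N"
    and "transverse_to_fiber_at M N z"
  shows "\<exists>F U V \<xi>.
    embedded_submanifold l M F \<and> bundle_proj z \<in> F \<and>
    openin (mtop M) U \<and> bundle_proj z \<in> U \<and>
    openin (mtop (tangent_bundle M)) V \<and> z \<in> V \<and>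
    vector_field_along M (F \<inter> U) \<xi> \<and>
    N \<inter> V = \<xi> ` (F \<inter> U)"
  using assms(1,3-5) by (rule transverse_submanifold_is_local_field)

end
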